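(* Let $d\ge3$, $\alpha>1$, $\beta>1/2$, and let $X_n=\sum_{k=0}^n\eta(S_k)$ be the random walk in random scenery on $\mathbb Z^d$ described in the context, with tail exponent $\alpha$. Assume moreover that the random variables $\{\eta(x),x\in\mathbb Z^d\}$ are bell-shaped, i.e. the law of $\eta(0)$ has a density with respect to Lebesgue measure which is even, and decreasing on $\mathbb R^+$. 1. (Region I) If $1\ge\beta>1/2$, then for any $y>0$ there is a constant $\underline c_1>0$ such that for all $n\ge1$, $P(X_n\ge n^\beta y)\ge\exp(-\underline c_1n^{2\beta-1})$. 2. (Region II) If $\beta\le1+1/\alpha$, then for any $y>0$ there is a constant $\underline c_2>0$ such that for all $n\ge1$, $P(X_n\ge n^\beta y)\ge\exp(-\underline c_2n^{\beta\alpha/(\alpha+1)})$. 3. (Region III) If $\beta\le1$, then for any $y>0$ there is a constant $\underline c_3>0$ such that for all $n\ge1$, $P(X_n\ge n^\beta y)\ge\exp(-\underline c_3n^{\beta\frac d{d+2}})$.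
   Context: $(S_k)_{k\ge0}$ is the nearest-neighbour symmetric (simple) random walk on $\mathbb Z^d$ with $S_0=0$, with law $\mathbb P_0$. The scenery $\{\eta(x):x\in\mathbb Z^d\}$ is a family of i.i.d. real centered random variables with law $P_\eta$, independent of the walk, such that $\lim_{t\to\infty}t^{-\alpha}\log P_\eta(\eta(0)>t)=-c$ for some constant $c>0$. $P=\mathbb P_0\otimes P_\eta$ is the joint law of walk and scenery. Constants do not depend on $n$. *)

theory Defs
  imports "HOL-Probability.Probability"
begin

definition nn_steps :: "(int ^ 'd::finite) set" where
  "nn_steps = {v. \<exists>i. v = axis i 1 \<or> v = axis i (-1)}"

(* The increments are i.i.d. and uniform on the 2d nearest neighbours of the origin. *)
definition simple_random_walk :: "'a measure \<Rightarrow> (nat \<Rightarrow> 'a \<Rightarrow> int ^ 'd::finite) \<Rightarrow> bool" where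
  "simple_random_walk M S \<longleftrightarrow>
     prob_space M \<and>
     (\<forall>k. S k \<in> measurable M (count_space UNIV)) \<and>
     (\<forall>\<omega>\<in>space M. S 0 \<omega> = 0) \<and>
     prob_space.indep_vars M (\<lambda>_. count_space UNIV) (\<lambda>k \<omega>. S (Suc k) \<omega> - S k \<omega>) UNIV \<and>
     (\<forall>k. distr M (count_space UNIV) (\<lambda>\<omega>. S (Suc k) \<omega> - S k \<omega>) = measure_pmf (pmf_of_set nn_steps))"

definition iid_centered_scenery :: "'b measure \<Rightarrow> (int ^ 'd::finite \<Rightarrow> 'b \<Rightarrow> real) \<Rightarrow> bool" where
  "iid_centered_scenery N \<eta> \<longleftrightarrow>
     prob_space N \<and>
     prob_space.indep_vars N (\<lambda>_. borel) \<eta> UNIV \<and>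
     (\<forall>x. distr N borel (\<eta> x) = distr N borel (\<eta> 0)) \<and>
     integrable N (\<eta> 0) \<and> integral\<^sup>L N (\<eta> 0) = 0"

definition has_tail_exponent :: "'b measure \<Rightarrow> ('b \<Rightarrow> real) \<Rightarrow> real \<Rightarrow> bool" where
  "has_tail_exponent N X \<alpha> \<longleftrightarrow>
     (\<exists>c>0. ((\<lambda>t. t powr (- \<alpha>) * ln (measure N {\<omega> \<in> space N. X \<omega> > t})) \<longlongrightarrow> - c) at_top)"

(* "Decreasing" is non-strict.  The density takes values in ennreal, so it may be
   unbounded near 0 (with value \<infinity> at the single point 0). *)
definition bell_shaped :: "'b measure \<Rightarrow> ('b \<Rightarrow> real) \<Rightarrow> bool" where
  "bell_shaped N X \<longleftrightarrow>
     (\<exists>g :: real \<Rightarrow> ennreal. distributed N lborel X g \<and>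
        (\<forall>x. g (- x) = g x) \<and> antimono_on {0..} g)"

definition rwrs :: "(nat \<Rightarrow> 'a \<Rightarrow> int ^ 'd::finite) \<Rightarrow> (int ^ 'd \<Rightarrow> 'b \<Rightarrow> real) \<Rightarrow> nat \<Rightarrow> 'a \<times> 'b \<Rightarrow> real" where
  "rwrs S \<eta> n \<omega> = (\<Sum>k=0..n. \<eta> (S k (fst \<omega>)) (snd \<omega>))"

end

theory Submission
  imports Defs "HOL-Real_Asymp.Real_Asymp"
begin

text \<open>Given the walk, the process is a weighted sum of the scenery with the local times as weights.
  By symmetry, the sites not controlled by a strategy contribute a nonnegative amount with
  probability at least 1/2, independently of the others, so they can be discarded at the cost of a
  factor 2.

  Region I: whatever the walk does, the visited sites can be split into independent blocks of local
  time about m, a small multiple of n to the power 2 - 2 beta, each contributing at least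
  a multiple of the square root of m with probability bounded below (Paley-Zygmund).
  Region II: the walk oscillates between the origin and a neighbour up to time
  n to the power beta alpha / (alpha + 1), and the scenery at the origin is large.
  Region III: the walk stays up to time n to the power beta in a box of side
  n to the power beta / (d + 2), and the scenery is at least y on the box.  The confinement
  probability is bounded below by a principal-eigenfunction argument on the box.\<close>

section \<open>Weighted sums of a symmetric i.i.d. scenery\<close>

text \<open>All bounds fix the walk first: if the conditional scenery probability is at least b for
  every path in an event A, then P(A) b is a lower bound. Region I takes A to be everything. The
  exponents come from balancing costs. Region I: n/m blocks worth sqrt m each give n / sqrt m, of
  order n^\<beta> when m has order n^(2-2\<beta>), at one constant factor per block. Region II: T
  oscillating steps cost exp(-const T), a value t at the origin costs exp(-const t^\<alpha>), and T
  t must have order n^\<beta>; T = t^\<alpha> fixes both. Region III: a box of side R costs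
  exp(-const R^d) for the scenery and exp(-const T/R^2) for confinement with T = n^\<beta>; equating
  them gives R. The upper limits on \<beta> in II and III say that T \<le> n. The obstacle in Region
  I is that the local times of an arbitrary path may be spread out or concentrated on few sites, so
  the block estimate must be uniform over the weights. The constants must serve every n \<ge> 1;
  costs are compared with a power z \<ge> 1 of n, which absorbs rounding and factors 2.\<close>

locale symmetric_iid = prob_space N for N :: "'b measure" +
  fixes \<eta> :: "'i \<Rightarrow> 'b \<Rightarrow> real"
  assumes indep: "indep_vars (\<lambda>_. borel) \<eta> UNIV"
    and ident: "distr N borel (\<eta> x) = distr N borel (\<eta> y)"
    and symm: "distr N borel (\<lambda>\<omega>. - \<eta> x \<omega>) = distr N borel (\<eta> x)"
begin

definition wsum :: "('i \<Rightarrow> real) \<Rightarrow> 'i set \<Rightarrow> 'b \<Rightarrow> real" where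
  "wsum w A \<omega> = (\<Sum>x\<in>A. w x * \<eta> x \<omega>)"

lemma random_variable_scenery [measurable]: "\<eta> x \<in> borel_measurable N"
  using indep by (auto simp: indep_vars_def)

lemma random_variable_wsum [measurable]: "wsum w A \<in> borel_measurable N"
  unfolding wsum_def by measurable

lemma wsum_empty [simp]: "wsum w {} \<omega> = 0"
  by (simp add: wsum_def)

lemma wsum_insert: "finite A \<Longrightarrow> x \<notin> A \<Longrightarrow> wsum w (insert x A) \<omega> = wsum w A \<omega> + w x * \<eta> x \<omega>"
  by (simp add: wsum_def)

lemma wsum_Un: "finite A \<Longrightarrow> finite B \<Longrightarrow> A \<inter> B = {} \<Longrightarrow> wsum w (A \<union> B) \<omega> = wsum w A \<omega> + wsum w B \<omega>"
  by (simp add: wsum_def sum.union_disjoint)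

lemma wsum_singleton [simp]: "wsum w {x} \<omega> = w x * \<eta> x \<omega>"
  by (simp add: wsum_def)

lemma prob_scenery_eq: "prob {\<omega>\<in>space N. \<eta> x \<omega> \<ge> t} = prob {\<omega>\<in>space N. \<eta> y \<omega> \<ge> t}"
proof -
  have "prob {\<omega>\<in>space N. \<eta> z \<omega> \<ge> t} = measure (distr N borel (\<eta> z)) {t..}" for z
    by (subst measure_distr) (auto intro!: arg_cong[where f=prob])
  then show ?thesis using ident[of x y] by metis
qed

lemma expectation_scenery_eq:
  assumes [measurable]: "f \<in> borel_measurable borel"
  shows "expectation (\<lambda>\<omega>. f (\<eta> x \<omega>) :: real) = expectation (\<lambda>\<omega>. f (\<eta> y \<omega>))"
proof -
  have "expectation (\<lambda>\<omega>. f (\<eta> z \<omega>)) = integral\<^sup>L (distr N borel (\<eta> z)) f" for z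
    by (subst integral_distr) auto
  then show ?thesis using ident[of x y] by metis
qed

lemma integrable_scenery_iff:
  assumes [measurable]: "f \<in> borel_measurable borel"
  shows "integrable N (\<lambda>\<omega>. f (\<eta> x \<omega>) :: real) \<longleftrightarrow> integrable N (\<lambda>\<omega>. f (\<eta> y \<omega>))"
proof -
  have "integrable N (\<lambda>\<omega>. f (\<eta> z \<omega>)) \<longleftrightarrow> integrable (distr N borel (\<eta> z)) f" for z
    by (subst integrable_distr_eq) auto
  then show ?thesis using ident[of x y] by metis
qed

text \<open>By independence the joint law on A is the product of the marginals, each invariant under
  negation. So the joint law is invariant, and the linear functional carries this over to the
  sum.\<close>

lemma distr_wsum_uminus:
  assumes "finite A"
  shows "distr N borel (\<lambda>\<omega>. - wsum w A \<omega>) = distr N borel (wsum w A)"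
\<comment> \<open>The characterisation of independence by a product law needs a nonempty index
  set.\<close>
proof (cases "A = {}")
  case True
  then show ?thesis by (simp add: wsum_def[abs_def])
next
  case False
  let ?P = "\<Pi>\<^sub>M i\<in>A. (borel :: real measure)"
  let ?f = "\<lambda>v. \<Sum>x\<in>A. w x * v x :: real"
  have f: "?f \<in> borel_measurable ?P" by measurable
  have indA: "indep_vars (\<lambda>_. borel) \<eta> A"
    using indep by (rule indep_vars_subset) simp
  have indA': "indep_vars (\<lambda>_. borel) (\<lambda>x \<omega>. - \<eta> x \<omega>) A"
    using indep_vars_compose2[OF indA, of "\<lambda>_. uminus" "\<lambda>_. borel"] by simp
  have "distr N ?P (\<lambda>\<omega>. \<lambda>x\<in>A. - \<eta> x \<omega>) = (\<Pi>\<^sub>M i\<in>A. distr N borel (\<lambda>\<omega>. - \<eta> i \<omega>))"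
    using indA' False by (subst (asm) indep_vars_iff_distr_eq_PiM) auto
  also have "\<dots> = (\<Pi>\<^sub>M i\<in>A. distr N borel (\<eta> i))"
    by (simp add: symm)
  also have "\<dots> = distr N ?P (\<lambda>\<omega>. \<lambda>x\<in>A. \<eta> x \<omega>)"
    using indA False by (subst (asm) indep_vars_iff_distr_eq_PiM) auto
  finally have eq: "distr N ?P (\<lambda>\<omega>. \<lambda>x\<in>A. - \<eta> x \<omega>) = distr N ?P (\<lambda>\<omega>. \<lambda>x\<in>A. \<eta> x \<omega>)" .
  have "distr N borel (\<lambda>\<omega>. - wsum w A \<omega>) = distr (distr N ?P (\<lambda>\<omega>. \<lambda>x\<in>A. - \<eta> x \<omega>)) borel ?f"
    by (subst distr_distr) (auto simp: wsum_def comp_def sum_negf intro!: distr_cong)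
  also have "\<dots> = distr N borel (wsum w A)"
    unfolding eq by (subst distr_distr) (auto simp: wsum_def comp_def intro!: distr_cong)
  finally show ?thesis .
qed

lemma prob_wsum_uminus:
  assumes "finite A"
  shows "prob {\<omega>\<in>space N. wsum w A \<omega> \<le> - t} = prob {\<omega>\<in>space N. wsum w A \<omega> \<ge> t}"
proof -
  have "prob {\<omega>\<in>space N. wsum w A \<omega> \<le> - t} = measure (distr N borel (\<lambda>\<omega>. - wsum w A \<omega>)) {t..}"
    by (subst measure_distr) (auto intro!: arg_cong[where f=prob])
  also have "\<dots> = prob {\<omega>\<in>space N. wsum w A \<omega> \<ge> t}"
    unfolding distr_wsum_uminus[OF assms]
    by (subst measure_distr) (auto intro!: arg_cong[where f=prob])
  finally show ?thesis .
qed

text \<open>The two tails have equal mass by symmetry, so a union bound loses only a factor 2. This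
  makes two-sided moment estimates one-sided.\<close>

lemma prob_wsum_ge_half_abs:
  assumes "finite A"
  shows "prob {\<omega>\<in>space N. \<bar>wsum w A \<omega>\<bar> \<ge> t} / 2 \<le> prob {\<omega>\<in>space N. wsum w A \<omega> \<ge> t}"
proof -
  have "prob {\<omega>\<in>space N. \<bar>wsum w A \<omega>\<bar> \<ge> t}
      \<le> prob ({\<omega>\<in>space N. wsum w A \<omega> \<ge> t} \<union> {\<omega>\<in>space N. wsum w A \<omega> \<le> - t})"
    by (rule finite_measure_mono) auto
  also have "\<dots> \<le> prob {\<omega>\<in>space N. wsum w A \<omega> \<ge> t} + prob {\<omega>\<in>space N. wsum w A \<omega> \<le> - t}"
    by (rule measure_Un_le) auto
  finally show ?thesis using prob_wsum_uminus[OF assms] by simp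
qed

lemma prob_wsum_nonneg:
  assumes "finite A"
  shows "prob {\<omega>\<in>space N. wsum w A \<omega> \<ge> 0} \<ge> 1/2"
  using prob_wsum_ge_half_abs[OF assms, of 0 w] by (simp add: prob_space)

lemma indep_wsum:
  assumes "A \<inter> B = {}"
  shows "indep_var borel (wsum w A) borel (wsum w B)"
proof -
  have "indep_var borel ((\<lambda>v. \<Sum>x\<in>A. w x * v x) \<circ> (\<lambda>\<omega>. restrict (\<lambda>i. \<eta> i \<omega>) A))
      borel ((\<lambda>v. \<Sum>x\<in>B. w x * v x) \<circ> (\<lambda>\<omega>. restrict (\<lambda>i. \<eta> i \<omega>) B))"
    by (rule indep_var_compose[OF indep_var_restrict[OF indep assms]]) auto
  also have "(\<lambda>v. \<Sum>x\<in>A. w x * v x) \<circ> (\<lambda>\<omega>. restrict (\<lambda>i. \<eta> i \<omega>) A) = wsum w A"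
    by (auto simp: wsum_def fun_eq_iff)
  also have "(\<lambda>v. \<Sum>x\<in>B. w x * v x) \<circ> (\<lambda>\<omega>. restrict (\<lambda>i. \<eta> i \<omega>) B) = wsum w B"
    by (auto simp: wsum_def fun_eq_iff)
  finally show ?thesis .
qed

text \<open>Disjoint sites give independent sums, and the two events together force the third. All
  strategies are assembled through this inequality.\<close>

lemma prob_wsum_Un:
  assumes "finite A" "finite B" "A \<inter> B = {}"
  shows "prob {\<omega>\<in>space N. wsum w A \<omega> \<ge> s} * prob {\<omega>\<in>space N. wsum w B \<omega> \<ge> t}
      \<le> prob {\<omega>\<in>space N. wsum w (A \<union> B) \<omega> \<ge> s + t}"
proof -
  have "prob {\<omega>\<in>space N. wsum w A \<omega> \<ge> s} * prob {\<omega>\<in>space N. wsum w B \<omega> \<ge> t}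
     = prob ((\<lambda>\<omega>. (wsum w A \<omega>, wsum w B \<omega>)) -` ({s..} \<times> {t..}) \<inter> space N)"
    by (subst indep_varD[OF indep_wsum[OF assms(3)]])
      (auto intro!: arg_cong2[where f="(*)"] arg_cong[where f=prob])
  also have "\<dots> \<le> prob {\<omega>\<in>space N. wsum w (A \<union> B) \<omega> \<ge> s + t}"
    using assms by (intro finite_measure_mono) (auto simp: wsum_Un)
  finally show ?thesis .
qed

text \<open>Since the weights are nonnegative, it suffices that every site of A carries a value at
  least L; independence gives the power.\<close>

lemma prob_wsum_ge_const:
  assumes "finite A" "\<And>x. x \<in> A \<Longrightarrow> w x \<ge> 0"
  shows "prob {\<omega>\<in>space N. wsum w A \<omega> \<ge> L * sum w A} \<ge> prob {\<omega>\<in>space N. \<eta> x0 \<omega> \<ge> L} ^ card A"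
  using assms
proof (induction A)
  case empty
  then show ?case by (simp add: prob_space)
next
  case (insert x A)
  let ?q = "prob {\<omega>\<in>space N. \<eta> x0 \<omega> \<ge> L}"
  have "?q \<le> prob {\<omega>\<in>space N. wsum w {x} \<omega> \<ge> L * w x}"
    unfolding prob_scenery_eq[where x=x0 and y=x]
    using insert.prems by (intro finite_measure_mono) (auto simp: mult.commute[of L] intro!: mult_left_mono)
  then have "?q ^ card (insert x A) \<le> prob {\<omega>\<in>space N. wsum w {x} \<omega> \<ge> L * w x} * prob {\<omega>\<in>space N. wsum w A \<omega> \<ge> L * sum w A}"
    using insert by (auto intro!: mult_mono)
  also have "\<dots> \<le> prob {\<omega>\<in>space N. wsum w ({x} \<union> A) \<omega> \<ge> L * w x + L * sum w A}"
    using insert by (intro prob_wsum_Un) auto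
  finally show ?case using insert by (simp add: distrib_left)
qed

lemma prob_wsum_superset:
  assumes "finite B" "A \<subseteq> B"
  shows "prob {\<omega>\<in>space N. wsum w A \<omega> \<ge> t} / 2 \<le> prob {\<omega>\<in>space N. wsum w B \<omega> \<ge> t}"
proof -
  have "prob {\<omega>\<in>space N. wsum w A \<omega> \<ge> t} * (1/2)
      \<le> prob {\<omega>\<in>space N. wsum w A \<omega> \<ge> t} * prob {\<omega>\<in>space N. wsum w (B - A) \<omega> \<ge> 0}"
    using assms by (intro mult_left_mono prob_wsum_nonneg) auto
  also have "\<dots> \<le> prob {\<omega>\<in>space N. wsum w (A \<union> (B - A)) \<omega> \<ge> t + 0}"
    using assms by (intro prob_wsum_Un) (auto intro: finite_subset)
  also have "A \<union> (B - A) = B" using assms by auto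
  finally show ?thesis by simp
qed

section \<open>Moments of weighted sums and the Paley-Zygmund bound\<close>

lemma expectation_odd_eq_0:
  assumes [measurable]: "f \<in> borel_measurable borel" and odd: "\<And>t. f (- t) = - f t"
  shows "expectation (\<lambda>\<omega>. f (\<eta> x \<omega>) :: real) = 0"
proof -
  have "expectation (\<lambda>\<omega>. f (\<eta> x \<omega>)) = integral\<^sup>L (distr N borel (\<lambda>\<omega>. - \<eta> x \<omega>)) f"
    unfolding symm by (subst integral_distr) auto
  also have "\<dots> = - expectation (\<lambda>\<omega>. f (\<eta> x \<omega>))"
    by (subst integral_distr) (auto simp: odd)
  finally show ?thesis by simp
qed

lemma integrable_lower_power:
  assumes [measurable]: "Z \<in> borel_measurable N" and int: "integrable N (\<lambda>\<omega>. (Z \<omega> :: real) ^ 4)" and "k \<le> 4"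
  shows "integrable N (\<lambda>\<omega>. Z \<omega> ^ k)"
proof (rule Bochner_Integration.integrable_bound)
  show "integrable N (\<lambda>\<omega>. 1 + Z \<omega> ^ 4)" using int by auto
  have "\<bar>z\<bar> ^ k \<le> 1 + z ^ 4" for z :: real
  proof (cases "\<bar>z\<bar> \<le> 1")
    case True
    then have "\<bar>z\<bar> ^ k \<le> 1" by (intro power_le_one) auto
    then show ?thesis by (smt (verit) zero_le_even_power even_numeral)
  next
    case False
    then have "\<bar>z\<bar> ^ k \<le> \<bar>z\<bar> ^ 4" using assms by (intro power_increasing) auto
    then show ?thesis by (simp add: power_even_abs)
  qed
  then show "AE \<omega> in N. norm (Z \<omega> ^ k) \<le> norm (1 + Z \<omega> ^ 4)"
    by (auto simp: power_abs abs_of_nonneg intro!: AE_I2)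
qed (use assms in measurable)

text \<open>One independent centered term Y is added at a time: mixed moments containing a first
  power vanish. Bounding the fourth moment by a fixed multiple of the squared sum of squares,
  whatever the weights, is what makes Paley-Zygmund uniform.\<close>

lemma wsum_moments:
  assumes "finite A" and int: "integrable N (\<lambda>\<omega>. \<eta> i \<omega> ^ 4)"
  defines "s2 \<equiv> expectation (\<lambda>\<omega>. \<eta> i \<omega> ^ 2)" and "k4 \<equiv> expectation (\<lambda>\<omega>. \<eta> i \<omega> ^ 4)"
  shows "integrable N (\<lambda>\<omega>. wsum w A \<omega> ^ 4) \<and> expectation (wsum w A) = 0 \<and>
    expectation (\<lambda>\<omega>. wsum w A \<omega> ^ 2) = s2 * (\<Sum>x\<in>A. (w x)\<^sup>2) \<and>
    expectation (\<lambda>\<omega>. wsum w A \<omega> ^ 4) \<le> (k4 + 3 * s2\<^sup>2) * (\<Sum>x\<in>A. (w x)\<^sup>2)\<^sup>2"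
  using assms(1)
proof (induction A)
  case empty
  then show ?case by simp
next
  case (insert x A)
  define Z where "Z = wsum w A"
  define Y where "Y = wsum w {x}"
  define V where "V = (\<Sum>x\<in>A. (w x)\<^sup>2)"
  have [measurable]: "Z \<in> borel_measurable N" "Y \<in> borel_measurable N" by (auto simp: Z_def Y_def)
  have Y: "Y \<omega> = w x * \<eta> x \<omega>" for \<omega> by (simp add: Y_def)
  have Z4: "integrable N (\<lambda>\<omega>. Z \<omega> ^ 4)" and Z1: "expectation Z = 0" 
    and Z2: "expectation (\<lambda>\<omega>. Z \<omega> ^ 2) = s2 * V"
    and Z4': "expectation (\<lambda>\<omega>. Z \<omega> ^ 4) \<le> (k4 + 3 * s2\<^sup>2) * V\<^sup>2"
    using insert.IH by (auto simp: Z_def V_def)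
  have x4: "integrable N (\<lambda>\<omega>. \<eta> x \<omega> ^ 4)"
    using int integrable_scenery_iff[of "\<lambda>t. t ^ 4" i x] by simp
  have Y4: "integrable N (\<lambda>\<omega>. Y \<omega> ^ 4)" using x4 by (auto simp: Y power_mult_distrib)
  have Zk: "integrable N (\<lambda>\<omega>. Z \<omega> ^ k)" if "k \<le> 4" for k
    by (rule integrable_lower_power[OF _ Z4 that]) simp
  have Yk: "integrable N (\<lambda>\<omega>. Y \<omega> ^ k)" if "k \<le> 4" for k
    by (rule integrable_lower_power[OF _ Y4 that]) simp
  have Y1: "expectation Y = 0" using expectation_odd_eq_0[of "\<lambda>t. t" x] by (simp add: Y[abs_def])
  have Y2: "expectation (\<lambda>\<omega>. Y \<omega> ^ 2) = s2 * (w x)\<^sup>2"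
    using expectation_scenery_eq[of "\<lambda>t. t ^ 2" x i] by (simp add: Y[abs_def] s2_def power_mult_distrib)
  have Y4': "expectation (\<lambda>\<omega>. Y \<omega> ^ 4) = k4 * ((w x)\<^sup>2)\<^sup>2"
    using expectation_scenery_eq[of "\<lambda>t. t ^ 4" x i] by (simp add: Y[abs_def] k4_def power_mult_distrib)
  have ind: "indep_var borel Z borel Y"
    unfolding Z_def Y_def using insert.hyps by (intro indep_wsum) auto
  have ind': "indep_var borel (\<lambda>\<omega>. Z \<omega> ^ j) borel (\<lambda>\<omega>. Y \<omega> ^ k)" for j k
    using indep_var_compose[OF ind, of "\<lambda>t. t ^ j" borel "\<lambda>t. t ^ k" borel] by (simp add: comp_def)
  have int_mix: "integrable N (\<lambda>\<omega>. Z \<omega> ^ j * Y \<omega> ^ k)" if "j \<le> 4" "k \<le> 4" for j k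
    using indep_var_integrable[OF ind' Zk Yk] that by simp
  have ex_mix: "expectation (\<lambda>\<omega>. Z \<omega> ^ j * Y \<omega> ^ k)
      = expectation (\<lambda>\<omega>. Z \<omega> ^ j) * expectation (\<lambda>\<omega>. Y \<omega> ^ k)" if "j \<le> 4" "k \<le> 4" for j k
    using indep_var_lebesgue_integral[OF ind' Zk Yk] that by simp
  have ZY: "wsum w (insert x A) \<omega> = Z \<omega> + Y \<omega>" for \<omega>
    using insert.hyps by (simp add: wsum_insert Z_def Y)
  have e2: "(Z \<omega> + Y \<omega>) ^ 2 = Z \<omega> ^ 2 + 2 * (Z \<omega> ^ 1 * Y \<omega> ^ 1) + Y \<omega> ^ 2" for \<omega>
    by (simp add: power2_eq_square algebra_simps)
  have e4: "(Z \<omega> + Y \<omega>) ^ 4 = Z \<omega> ^ 4 + 4 * (Z \<omega> ^ 3 * Y \<omega> ^ 1) + 6 * (Z \<omega> ^ 2 * Y \<omega> ^ 2)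
      + 4 * (Z \<omega> ^ 1 * Y \<omega> ^ 3) + Y \<omega> ^ 4" for \<omega>
    by (simp add: power4_eq_xxxx power3_eq_cube power2_eq_square algebra_simps)
  have i4: "integrable N (\<lambda>\<omega>. (Z \<omega> + Y \<omega>) ^ 4)"
    unfolding e4 by (intro Bochner_Integration.integrable_add integrable_mult_right int_mix Zk Yk) auto
  have E1: "expectation (\<lambda>\<omega>. Z \<omega> + Y \<omega>) = 0"
    using Zk[of 1] Yk[of 1] Z1 Y1 by simp
  have E2: "expectation (\<lambda>\<omega>. (Z \<omega> + Y \<omega>) ^ 2) = s2 * V + s2 * (w x)\<^sup>2"
    unfolding e2 using Z1 Y1 Z2 Y2 Zk[of 2] Yk[of 2] int_mix[of 1 1] ex_mix[of 1 1] by simp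
  have "expectation (\<lambda>\<omega>. (Z \<omega> + Y \<omega>) ^ 4)
      = expectation (\<lambda>\<omega>. Z \<omega> ^ 4) + 6 * (s2 * V * (s2 * (w x)\<^sup>2)) + k4 * ((w x)\<^sup>2)\<^sup>2"
    unfolding e4 using Z1 Y1 Z2 Y2 Y4' Z4 Y4 int_mix[of 1 3] ex_mix[of 1 3] int_mix[of 2 2] ex_mix[of 2 2] 
      int_mix[of 3 1] ex_mix[of 3 1] by simp
  also have "\<dots> \<le> (k4 + 3 * s2\<^sup>2) * V\<^sup>2 + 6 * (s2 * V * (s2 * (w x)\<^sup>2)) + k4 * ((w x)\<^sup>2)\<^sup>2"
    using Z4' by simp
  \<comment> \<open>With W the new squared weight, the two sides differ by 2 \<open>k4\<close> V W +
    3 \<open>s2\<close>^2 W^2. The coefficient 3 is exactly what pays for the cross term 6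
    \<open>s2\<close>^2 V W.\<close>
  also have "\<dots> \<le> (k4 + 3 * s2\<^sup>2) * (V + (w x)\<^sup>2)\<^sup>2"
  proof -
    have "0 \<le> k4" unfolding k4_def by (intro integral_nonneg_AE) auto
    moreover have "0 \<le> V" unfolding V_def by (intro sum_nonneg) auto
    ultimately have "0 \<le> 2 * k4 * V * (w x)\<^sup>2 + 3 * s2\<^sup>2 * ((w x)\<^sup>2)\<^sup>2" by auto
    then show ?thesis by (simp add: power2_eq_square algebra_simps)
  qed
  finally have E4: "expectation (\<lambda>\<omega>. (Z \<omega> + Y \<omega>) ^ 4) \<le> (k4 + 3 * s2\<^sup>2) * (V + (w x)\<^sup>2)\<^sup>2" .
  show ?case
    using i4 E1 E2 E4 insert.hyps by (simp add: ZY V_def add.commute algebra_simps)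
qed

end

context symmetric_iid
begin

text \<open>With V the sum of squared weights, the second moment is s2 V and the fourth at most C
  V^2, so their normalised ratio is bounded independently of the weights. Symmetry removes the
  absolute value.\<close>

lemma paley_zygmund_wsum:
  assumes int: "integrable N (\<lambda>\<omega>. \<eta> i \<omega> ^ 4)" and pos: "expectation (\<lambda>\<omega>. \<eta> i \<omega> ^ 2) > 0"
  obtains \<theta> p where "\<theta> > 0" "p > 0"
    "\<And>A w. finite A \<Longrightarrow> prob {\<omega>\<in>space N. wsum w A \<omega> \<ge> \<theta> * sqrt (\<Sum>x\<in>A. (w x)\<^sup>2)} \<ge> p"
proof -
  define s2 where "s2 = expectation (\<lambda>\<omega>. \<eta> i \<omega> ^ 2)"
  define k4 where "k4 = expectation (\<lambda>\<omega>. \<eta> i \<omega> ^ 4)"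
  define C where "C = k4 + 3 * s2\<^sup>2"
  have s2: "s2 > 0" using pos by (simp add: s2_def)
  have "k4 \<ge> 0" unfolding k4_def by (intro integral_nonneg_AE) auto
  then have C: "C > 0" "s2\<^sup>2 \<le> C" using s2 by (auto simp: C_def intro: add_nonneg_pos)
  define \<theta> where "\<theta> = sqrt s2 / 2"
  have \<theta>: "\<theta> > 0" "\<theta>\<^sup>2 = s2 / 4" using s2 by (auto simp: \<theta>_def power_divide)
  have "prob {\<omega>\<in>space N. wsum w A \<omega> \<ge> \<theta> * sqrt (\<Sum>x\<in>A. (w x)\<^sup>2)} \<ge> s2\<^sup>2 / (16 * C)"
    if A: "finite A" for A w
  proof (cases "(\<Sum>x\<in>A. (w x)\<^sup>2) = 0")
    case True
    have "s2\<^sup>2 / (16 * C) \<le> 1 / 2" using C by (simp add: field_simps)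
    then show ?thesis unfolding True using prob_wsum_nonneg[OF A, of w] by simp
  next
    case False
    define Z where "Z = wsum w A"
    define V where "V = (\<Sum>x\<in>A. (w x)\<^sup>2)"
    have V: "V > 0" using False by (simp add: V_def order_less_le sum_nonneg)
    have [measurable]: "Z \<in> borel_measurable N" by (simp add: Z_def)
    have Z4: "integrable N (\<lambda>\<omega>. Z \<omega> ^ 4)" and EZ2: "expectation (\<lambda>\<omega>. Z \<omega> ^ 2) = s2 * V"
      and EZ4: "expectation (\<lambda>\<omega>. Z \<omega> ^ 4) \<le> C * V\<^sup>2"
      using wsum_moments[OF A int, of w] by (auto simp: Z_def V_def C_def s2_def k4_def)
    have Z2: "integrable N (\<lambda>\<omega>. Z \<omega> ^ 2)"
      by (rule integrable_lower_power[OF _ Z4]) auto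
    define E where "E = {\<omega>\<in>space N. \<bar>Z \<omega>\<bar> \<ge> \<theta> * sqrt V}"
    have [measurable]: "E \<in> events" by (simp add: E_def)
    \<comment> \<open>This k makes the fourth-moment term C V^2 / k a quarter of the second moment
      s2 V. The choice of \<theta> does the same for the complement of E, which leaves half of s2 V
      for k P(E).\<close>
    define k where "k = 4 * C * V / s2"
    have k: "k > 0" using C V s2 by (simp add: k_def)
    \<comment> \<open>A pointwise substitute for Cauchy-Schwarz: off E the value is small, and on E
      one uses a b \<le> a^2 + b^2 with b = k and divides by k.\<close>
    have pw: "(Z \<omega>)\<^sup>2 \<le> \<theta>\<^sup>2 * V + Z \<omega> ^ 4 / k + k * indicator E \<omega>" if "\<omega> \<in> space N" for \<omega>
    proof (cases "\<omega> \<in> E")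
      case False
      then have "\<bar>Z \<omega>\<bar> \<le> \<theta> * sqrt V" using that by (auto simp: E_def)
      then have "\<bar>Z \<omega>\<bar>\<^sup>2 \<le> (\<theta> * sqrt V)\<^sup>2" by (rule power_mono) simp
      also have "\<dots> = \<theta>\<^sup>2 * V" using V by (simp add: power_mult_distrib)
      finally show ?thesis using False k by (simp add: add_increasing2)
    next
      case True
      have "(Z \<omega>)\<^sup>2 * k \<le> ((Z \<omega>)\<^sup>2)\<^sup>2 + k\<^sup>2"
      proof -
        have "0 \<le> (Z \<omega>)\<^sup>2 * k" using k by simp
        then show ?thesis using sum_squares_bound[of "(Z \<omega>)\<^sup>2" k] by linarith
      qed
      then have "(Z \<omega>)\<^sup>2 \<le> Z \<omega> ^ 4 / k + k"
        using k by (simp add: field_simps power2_eq_square power4_eq_xxxx)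
      moreover have "0 \<le> \<theta>\<^sup>2 * V" using V by simp
      ultimately show ?thesis using True by simp
    qed
    have iE: "integrable N (indicator E :: _ \<Rightarrow> real)" by (rule integrable_real_indicator) (auto simp: emeasure_eq_measure)
    have "s2 * V \<le> expectation (\<lambda>\<omega>. \<theta>\<^sup>2 * V + Z \<omega> ^ 4 / k + k * indicator E \<omega>)"
      unfolding EZ2[symmetric] using Z2 Z4 iE pw
      by (intro integral_mono Bochner_Integration.integrable_add integrable_mult_right integrable_divide) auto
    also have "\<dots> = \<theta>\<^sup>2 * V + expectation (\<lambda>\<omega>. Z \<omega> ^ 4) / k + k * prob E"
      using Z4 iE by (simp add: prob_space)
    also have "\<dots> \<le> s2 / 4 * V + C * V\<^sup>2 / k + k * prob E"
      using divide_right_mono[OF EZ4, of k] k unfolding \<theta>(2) by simp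
    also have "C * V\<^sup>2 / k = s2 / 4 * V" using C V s2 by (simp add: k_def field_simps power2_eq_square)
    finally have "s2 * V / 2 \<le> k * prob E" by (simp add: field_simps)
    then have "s2\<^sup>2 / (8 * C) \<le> prob E"
      using C V s2 by (simp add: k_def field_simps power2_eq_square)
    then have "s2\<^sup>2 / (16 * C) \<le> prob E / 2" using C by (simp add: field_simps)
    also have "\<dots> \<le> prob {\<omega>\<in>space N. Z \<omega> \<ge> \<theta> * sqrt V}"
      unfolding E_def Z_def by (rule prob_wsum_ge_half_abs[OF A])
    finally show ?thesis by (simp add: Z_def V_def)
  qed
  moreover have "s2\<^sup>2 / (16 * C) > 0" using s2 C by simp
  ultimately show ?thesis using that \<theta> by blast
qed

end

section \<open>Decomposition of the weights into blocks\<close>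

text \<open>When elements are added one by one, the first sum to reach m overshoots it by at most
  one weight.\<close>

lemma exists_subset_sum_between:
  fixes w :: "'i \<Rightarrow> real"
  assumes "finite A" "0 \<le> m" "\<And>x. x \<in> A \<Longrightarrow> w x \<le> m" "sum w A \<ge> m"
  shows "\<exists>B\<subseteq>A. m \<le> sum w B \<and> sum w B \<le> 2 * m"
  using assms
proof (induction A)
  case empty
  then show ?case by auto
next
  case (insert x A)
  show ?case
  proof (cases "sum w A \<ge> m")
    case True
    then obtain B where "B \<subseteq> A" "m \<le> sum w B \<and> sum w B \<le> 2 * m"
      using insert by auto
    then show ?thesis by auto
  next
    case False
    moreover have "w x \<le> m" using insert.prems by auto
    ultimately have "sum w (insert x A) \<le> 2 * m" using insert.hyps by simp
    then show ?thesis using insert.prems by auto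
  qed
qed

context symmetric_iid
begin

text \<open>Blocks B of mass at least m are peeled off whose l2 norm is at least
  \<open>sum w B / (2 * sqrt m)\<close>. Each costs a factor p, and there are at most
  \<open>sum w A / m\<close> of them. A remainder of mass below m is left to symmetry: hence the
  factor 1/2 and the loss of m in the threshold.\<close>

lemma prob_wsum_blocks:
  assumes \<theta>: "\<theta> > 0" and p: "p > 0"
    and pz: "\<And>B w. finite B \<Longrightarrow> prob {\<omega>\<in>space N. wsum w B \<omega> \<ge> \<theta> * sqrt (\<Sum>x\<in>B. (w x)\<^sup>2)} \<ge> p"
    and m: "m \<ge> 1"
    and A: "finite A" "\<And>x. x \<in> A \<Longrightarrow> w x \<ge> 1"
  shows "p powr (sum w A / m) / 2 \<le> prob {\<omega>\<in>space N. wsum w A \<omega> \<ge> \<theta> * (sum w A - m) / (2 * sqrt m)}"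
  using A
proof (induction A rule: finite_psubset_induct)
  case (psubset A)
  have p1: "p \<le> 1" using pz[of "{}" w] prob_le_1 order_trans by blast
  show ?case
  proof (cases "sum w A < m")
    case True
    have "0 \<le> sum w A" using psubset.prems by (intro sum_nonneg) (auto intro: order_trans[OF zero_le_one])
    then have "p powr (sum w A / m) \<le> 1"
      using p p1 m by (intro powr_le1) auto
    then have "p powr (sum w A / m) / 2 \<le> prob {\<omega>\<in>space N. wsum w A \<omega> \<ge> 0}"
      using prob_wsum_nonneg[OF psubset.hyps(1), of w] by simp
    also have "\<dots> \<le> prob {\<omega>\<in>space N. wsum w A \<omega> \<ge> \<theta> * (sum w A - m) / (2 * sqrt m)}"
    proof (intro finite_measure_mono)
      have "\<theta> * (sum w A - m) / (2 * sqrt m) \<le> 0"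
        using \<theta> True m by (intro divide_nonpos_pos mult_nonneg_nonpos) auto
      then show "{\<omega>\<in>space N. wsum w A \<omega> \<ge> 0} \<subseteq> {\<omega>\<in>space N. wsum w A \<omega> \<ge> \<theta> * (sum w A - m) / (2 * sqrt m)}"
        by auto
    qed auto
    finally show ?thesis .
  next
    case False
    \<comment> \<open>A block is either one site of weight at least m, whose l2 norm is its weight,
      or light sites of total mass in [m, 2 m]. In the second case w \<ge> 1 gives w \<le> w^2, so
      the l2 norm is at least sqrt m.\<close>
    have "\<exists>B\<subseteq>A. m \<le> sum w B \<and> sum w B \<le> 2 * sqrt m * sqrt (\<Sum>x\<in>B. (w x)\<^sup>2)"
    proof (cases "\<exists>x\<in>A. w x \<ge> m")
      case True
      then obtain x where x: "x \<in> A" "w x \<ge> m" by auto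
      have "1 \<le> sqrt m" using m by simp
      then have "1 \<le> 2 * sqrt m" by linarith
      then have "1 * w x \<le> (2 * sqrt m) * w x"
        using m x by (intro mult_right_mono) auto
      then show ?thesis using x m by (intro exI[of _ "{x}"]) auto
    next
      case no: False
      have "\<exists>B\<subseteq>A. m \<le> sum w B \<and> sum w B \<le> 2 * m"
      proof (rule exists_subset_sum_between[OF psubset.hyps(1)])
        show "w x \<le> m" if "x \<in> A" for x using no that by force
      qed (use False m in linarith)+
      then obtain B where B: "B \<subseteq> A" "m \<le> sum w B" "sum w B \<le> 2 * m" by blast
      have "sum w B \<le> (\<Sum>x\<in>B. (w x)\<^sup>2)"
        using psubset.prems B(1) by (intro sum_mono self_le_power) auto
      then have "sqrt m \<le> sqrt (\<Sum>x\<in>B. (w x)\<^sup>2)" using B by auto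
      then have "sqrt m * sqrt m \<le> sqrt m * sqrt (\<Sum>x\<in>B. (w x)\<^sup>2)"
        using m by (intro mult_left_mono) auto
      then show ?thesis using B m by auto
    qed
    then obtain B where B: "B \<subseteq> A" "m \<le> sum w B" "sum w B \<le> 2 * sqrt m * sqrt (\<Sum>x\<in>B. (w x)\<^sup>2)"
      by auto
    have fin: "finite B" "finite (A - B)" using B psubset.hyps by (auto intro: finite_subset)
    have "B \<noteq> {}" using B m by auto
    then have "A - B \<subset> A" using B by auto
    then have IH: "p powr (sum w (A - B) / m) / 2
        \<le> prob {\<omega>\<in>space N. wsum w (A - B) \<omega> \<ge> \<theta> * (sum w (A - B) - m) / (2 * sqrt m)}"
      using psubset by auto
    have sums: "sum w A = sum w B + sum w (A - B)"
      using sum.subset_diff[OF B(1) psubset.hyps(1), of w] by simp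
    have AB: "B \<union> (A - B) = A" using B by auto
    have "p \<le> prob {\<omega>\<in>space N. wsum w B \<omega> \<ge> \<theta> * sqrt (\<Sum>x\<in>B. (w x)\<^sup>2)}"
      using pz fin by auto
    also have "\<dots> \<le> prob {\<omega>\<in>space N. wsum w B \<omega> \<ge> \<theta> * sum w B / (2 * sqrt m)}"
    proof (intro finite_measure_mono)
      have "\<theta> * sum w B / (2 * sqrt m) \<le> \<theta> * sqrt (\<Sum>x\<in>B. (w x)\<^sup>2)"
        using B(3) \<theta> m by (simp add: field_simps)
      then show "{\<omega>\<in>space N. wsum w B \<omega> \<ge> \<theta> * sqrt (\<Sum>x\<in>B. (w x)\<^sup>2)}
          \<subseteq> {\<omega>\<in>space N. wsum w B \<omega> \<ge> \<theta> * sum w B / (2 * sqrt m)}" by auto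
    qed auto
    finally have PB: "p \<le> prob {\<omega>\<in>space N. wsum w B \<omega> \<ge> \<theta> * sum w B / (2 * sqrt m)}" .
    \<comment> \<open>Removing B lowers the exponent by at least 1, which pays for the factor p
      \<le> 1.\<close>
    have "p powr (sum w B / m) \<le> p powr 1"
      using p p1 B m by (intro powr_mono') auto
    then have "p powr (sum w A / m) / 2 \<le> p * (p powr (sum w (A - B) / m) / 2)"
      using p by (simp add: sums add_divide_distrib powr_add mult_right_mono)
    also have "\<dots> \<le> prob {\<omega>\<in>space N. wsum w B \<omega> \<ge> \<theta> * sum w B / (2 * sqrt m)}
      * prob {\<omega>\<in>space N. wsum w (A - B) \<omega> \<ge> \<theta> * (sum w (A - B) - m) / (2 * sqrt m)}"
      using PB IH p by (intro mult_mono) auto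
    also have "\<dots> \<le> prob {\<omega>\<in>space N. wsum w (B \<union> (A - B)) \<omega> \<ge> \<theta> * sum w B / (2 * sqrt m) + \<theta> * (sum w (A - B) - m) / (2 * sqrt m)}"
      using fin by (intro prob_wsum_Un) auto
    also have "\<theta> * sum w B / (2 * sqrt m) + \<theta> * (sum w (A - B) - m) / (2 * sqrt m)
      = \<theta> * (sum w A - m) / (2 * sqrt m)"
      by (simp add: sums add_divide_distrib[symmetric] algebra_simps)
    finally show ?thesis unfolding AB .
  qed
qed

end

section \<open>Tail and symmetry of the scenery\<close>

text \<open>For large t the limit holds up to a factor 2 in the constant. The upper bound is
  weakened to exponential decay through t \<le> t^\<alpha>, enough for a finite fourth
  moment.\<close>

lemma has_tail_exponent_bounds:
  assumes "has_tail_exponent N X \<alpha>" and "\<alpha> \<ge> 1"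
  obtains c t0 where "c > 0" "t0 \<ge> 1"
    "\<And>t. t \<ge> t0 \<Longrightarrow> exp (- 2 * c * t powr \<alpha>) \<le> measure N {\<omega>\<in>space N. X \<omega> > t}"
    "\<And>t. t \<ge> t0 \<Longrightarrow> measure N {\<omega>\<in>space N. X \<omega> > t} \<le> exp (- (c / 2) * t)"
proof -
  let ?p = "\<lambda>t. measure N {\<omega>\<in>space N. X \<omega> > t}"
  obtain c where c: "c > 0" and lim: "((\<lambda>t. t powr (- \<alpha>) * ln (?p t)) \<longlongrightarrow> - c) at_top"
    using assms(1) unfolding has_tail_exponent_def by auto
  have "eventually (\<lambda>t. - (2 * c) < t powr (- \<alpha>) * ln (?p t)) at_top"
    and "eventually (\<lambda>t. t powr (- \<alpha>) * ln (?p t) < - (c / 2)) at_top"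
    using order_tendstoD[OF lim] c by auto
  then have "eventually (\<lambda>t. - (2 * c) < t powr (- \<alpha>) * ln (?p t) \<and> t powr (- \<alpha>) * ln (?p t) < - (c / 2)) at_top"
    by eventually_elim auto
  then obtain t1 where t1: "\<And>t. t \<ge> t1 \<Longrightarrow> - (2 * c) < t powr (- \<alpha>) * ln (?p t)"
    "\<And>t. t \<ge> t1 \<Longrightarrow> t powr (- \<alpha>) * ln (?p t) < - (c / 2)"
    unfolding eventually_at_top_linorder by auto
  have bounds: "exp (- 2 * c * t powr \<alpha>) \<le> ?p t \<and> ?p t \<le> exp (- (c / 2) * t)" if t: "t \<ge> max t1 1" for t
  proof -
    have tp: "t powr \<alpha> > 0" "t powr \<alpha> * t powr (- \<alpha>) = 1" using t by (auto simp: powr_minus field_simps)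
    \<comment> \<open>Because \<open>ln 0 = 0\<close>, a vanishing tail would make the product 0,
      against its negative upper bound. Positivity is needed to invert the logarithm.\<close>
    have "?p t \<noteq> 0"
    proof
      assume "?p t = 0"
      then show False using t1(2)[of t] t c by simp
    qed
    then have pos: "?p t > 0" using measure_nonneg[of N] by (simp add: order_less_le)
    have ln: "ln (?p t) = t powr \<alpha> * (t powr (- \<alpha>) * ln (?p t))"
      using tp by (simp add: mult.assoc[symmetric])
    have "t powr \<alpha> * - (2 * c) \<le> ln (?p t)"
      using tp t1(1)[of t] t by (subst ln, intro mult_left_mono) auto
    then have 1: "exp (- 2 * c * t powr \<alpha>) \<le> ?p t"
      using pos by (simp add: ln_ge_iff mult_ac)
    have "t powr 1 \<le> t powr \<alpha>" using t assms(2) by (intro powr_mono) auto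
    then have tt: "t \<le> t powr \<alpha>" using t by simp
    have "ln (?p t) \<le> t powr \<alpha> * - (c / 2)"
      using tp t1(2)[of t] t by (subst ln, intro mult_left_mono) auto
    also have "\<dots> \<le> t * - (c / 2)" using tt c by (intro mult_right_mono_neg) auto
    finally have "exp (ln (?p t)) \<le> exp (- (c / 2) * t)" by (simp add: mult_ac)
    then show ?thesis using 1 pos by simp
  qed
  show ?thesis by (rule that[OF c, of "max t1 1"]) (use bounds in auto)
qed

text \<open>Substitution of -x for x: the density is even and Lebesgue measure is invariant under
  reflection.\<close>

lemma distr_uminus_bell_shaped:
  assumes "bell_shaped N X"
  shows "distr N borel (\<lambda>\<omega>. - X \<omega>) = distr N borel X"
proof -
  obtain g where D: "distributed N lborel X g" and even: "\<And>x. g (- x) = g x"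
    using assms unfolding bell_shaped_def by auto
  have X [measurable]: "X \<in> borel_measurable N" using distributed_measurable[OF D] by simp
  have g [measurable]: "g \<in> borel_measurable borel" using distributed_borel_measurable[OF D] by simp
  show ?thesis
  proof (rule measure_eqI)
    fix B assume "B \<in> sets (distr N borel (\<lambda>\<omega>. - X \<omega>))"
    then have B [measurable]: "B \<in> sets borel" by simp
    have uB [measurable]: "uminus -` B \<in> sets (borel :: real measure)"
      using measurable_sets[of uminus borel borel B] by simp
    have "emeasure (distr N borel (\<lambda>\<omega>. - X \<omega>)) B = emeasure N (X -` (uminus -` B) \<inter> space N)"
      by (subst emeasure_distr) (auto intro!: arg_cong[where f="emeasure N"])
    also have "\<dots> = (\<integral>\<^sup>+x. g x * indicator (uminus -` B) x \<partial>lborel)"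
      by (rule distributed_emeasure[OF D]) simp
    also have "\<dots> = (\<integral>\<^sup>+x. g (- x) * indicator B (- x) \<partial>lborel)"
      by (intro nn_integral_cong) (auto simp: even indicator_def)
    also have "\<dots> = (\<integral>\<^sup>+x. g x * indicator B x \<partial>distr lborel borel uminus)"
      by (subst nn_integral_distr) auto
    also have "\<dots> = (\<integral>\<^sup>+x. g x * indicator B x \<partial>lborel)"
      by (simp add: lborel_distr_uminus)
    also have "\<dots> = emeasure N (X -` B \<inter> space N)"
      by (rule distributed_emeasure[OF D, symmetric]) simp
    also have "\<dots> = emeasure (distr N borel X) B"
      by (simp add: emeasure_distr)
    finally show "emeasure (distr N borel (\<lambda>\<omega>. - X \<omega>)) B = emeasure (distr N borel X) B" .
  qed simp
qed

lemma symmetric_iid_scenery: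
  assumes "iid_centered_scenery N \<eta>" "bell_shaped N (\<eta> 0)"
  shows "symmetric_iid N \<eta>"
proof -
  interpret prob_space N using assms(1) by (simp add: iid_centered_scenery_def)
  have ind: "indep_vars (\<lambda>_. borel) \<eta> UNIV" and id: "\<And>x. distr N borel (\<eta> x) = distr N borel (\<eta> 0)"
    using assms(1) by (auto simp: iid_centered_scenery_def)
  have [measurable]: "\<eta> x \<in> borel_measurable N" for x using ind by (auto simp: indep_vars_def)
  show ?thesis
  proof
    show "distr N borel (\<eta> x) = distr N borel (\<eta> y)" for x y using id by metis
    have "distr N borel (\<lambda>\<omega>. - \<eta> x \<omega>) = distr (distr N borel (\<eta> x)) borel uminus" for x
      by (subst distr_distr) (auto simp: comp_def)
    then show "distr N borel (\<lambda>\<omega>. - \<eta> x \<omega>) = distr N borel (\<eta> x)" for x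
      using id distr_uminus_bell_shaped[OF assms(2)] by metis
  qed (rule ind)
qed

context symmetric_iid
begin

text \<open>Splitting by the integer part k of |\<eta>| bounds the fourth moment by the sum of
  (k+1)^4 P(|\<eta>| \<ge> k). Symmetry reduces these two-sided tails to the one-sided
  hypothesis.\<close>

lemma integrable_power4_if_exp_tail:
  assumes c: "c > 0" and bd: "\<And>t. t \<ge> t0 \<Longrightarrow> prob {\<omega>\<in>space N. \<eta> i \<omega> > t} \<le> exp (- c * t)"
  shows "integrable N (\<lambda>\<omega>. \<eta> i \<omega> ^ 4)"
proof (rule integrableI_nonneg)
  define P where "P k = prob {\<omega>\<in>space N. \<bar>\<eta> i \<omega>\<bar> \<ge> real k}" for k :: nat
  have Pk: "P k \<le> 2 * exp (- c / 2 * real k)" if k: "k > 0" "real k \<ge> 2 * t0" for k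
  proof -
    have "P k / 2 \<le> prob {\<omega>\<in>space N. \<eta> i \<omega> \<ge> real k}"
      using prob_wsum_ge_half_abs[of "{i}" "real k" "\<lambda>_. 1"] by (simp add: P_def)
    \<comment> \<open>The hypothesis concerns a strict inequality. Passing to level k/2 secures it
      at the price of half the rate, whence the requirement k \<ge> 2 \<open>t0\<close>.\<close>
    also have "\<dots> \<le> prob {\<omega>\<in>space N. \<eta> i \<omega> > real k / 2}"
      using k by (intro finite_measure_mono) auto
    also have "\<dots> \<le> exp (- c * (real k / 2))" using k by (intro bd) auto
    finally show ?thesis by simp
  qed
  have "(\<lambda>k. real (k + 1) ^ 4 * (2 * exp (- c / 2 * real k))) \<in> O(\<lambda>k. 1 / real k ^ 2)"
    using c by real_asymp
  moreover have "(\<lambda>k. real (k + 1) ^ 4 * P k) \<in> O(\<lambda>k. real (k + 1) ^ 4 * (2 * exp (- c / 2 * real k)))"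
  proof (rule bigoI[of _ 1])
    have "eventually (\<lambda>k. k > 0 \<and> real k \<ge> 2 * t0) sequentially"
      using eventually_conj[OF eventually_gt_at_top[of 0] eventually_ge_at_top[of "nat \<lceil>2 * t0\<rceil>"]]
      by eventually_elim (auto simp: nat_ceiling_le_eq)
    then show "eventually (\<lambda>k. norm (real (k + 1) ^ 4 * P k) \<le> 1 * norm (real (k + 1) ^ 4 * (2 * exp (- c / 2 * real k)))) sequentially"
    proof eventually_elim
      case (elim k)
      then show ?case using Pk[of k] by (auto simp: P_def norm_mult intro!: mult_left_mono)
    qed
  qed
  ultimately have "(\<lambda>k. real (k + 1) ^ 4 * P k) \<in> O(\<lambda>k. 1 / real k ^ 2)"
    by (rule landau_o.big_trans[rotated])
  moreover have "summable (\<lambda>k. norm (1 / real k ^ 2))"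
    using inverse_power_summable[of 2, where 'a=real] by (simp add: inverse_eq_divide)
  ultimately have sm: "summable (\<lambda>k. real (k + 1) ^ 4 * P k)"
    by (rule summable_comparison_test_bigo[rotated])
  have "(\<integral>\<^sup>+\<omega>. ennreal (\<eta> i \<omega> ^ 4) \<partial>N)
     \<le> (\<integral>\<^sup>+\<omega>. (\<Sum>k. ennreal (real (k + 1) ^ 4) * indicator {\<omega>\<in>space N. \<bar>\<eta> i \<omega>\<bar> \<ge> real k} \<omega>) \<partial>N)"
  proof (rule nn_integral_mono)
    fix \<omega> assume w: "\<omega> \<in> space N"
    define k where "k = nat \<lfloor>\<bar>\<eta> i \<omega>\<bar>\<rfloor>"
    have k: "real k \<le> \<bar>\<eta> i \<omega>\<bar>" "\<bar>\<eta> i \<omega>\<bar> \<le> real (k + 1)" unfolding k_def by linarith+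
    have "\<eta> i \<omega> ^ 4 = \<bar>\<eta> i \<omega>\<bar> ^ 4" by (simp add: power_even_abs)
    also have "\<dots> \<le> real (k + 1) ^ 4" using k(2) by (intro power_mono) auto
    finally have "ennreal (\<eta> i \<omega> ^ 4) \<le> ennreal (real (k + 1) ^ 4)" by (rule ennreal_leI)
    also have "\<dots> = (\<Sum>j\<in>{k}. ennreal (real (j + 1) ^ 4) * indicator {\<omega>\<in>space N. \<bar>\<eta> i \<omega>\<bar> \<ge> real j} \<omega>)"
      using w k by simp
    also have "\<dots> \<le> (\<Sum>j. ennreal (real (j + 1) ^ 4) * indicator {\<omega>\<in>space N. \<bar>\<eta> i \<omega>\<bar> \<ge> real j} \<omega>)"
      by (rule sum_le_suminf) auto
    finally show "ennreal (\<eta> i \<omega> ^ 4) \<le> (\<Sum>j. ennreal (real (j + 1) ^ 4) * indicator {\<omega>\<in>space N. \<bar>\<eta> i \<omega>\<bar> \<ge> real j} \<omega>)" .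
  qed
  also have "\<dots> = (\<Sum>k. ennreal (real (k + 1) ^ 4 * P k))"
    by (subst nn_integral_suminf)
      (auto simp: nn_integral_cmult P_def emeasure_eq_measure ennreal_mult intro!: suminf_cong)
  also have "\<dots> = ennreal (\<Sum>k. real (k + 1) ^ 4 * P k)"
    by (rule suminf_ennreal_eq) (use sm in \<open>auto simp: P_def summable_sums\<close>)
  also have "\<dots> < \<infinity>" by simp
  finally show "(\<integral>\<^sup>+\<omega>. ennreal (\<eta> i \<omega> ^ 4) \<partial>N) < \<infinity>" .
  show "(\<lambda>\<omega>. \<eta> i \<omega> ^ 4) \<in> borel_measurable N" by measurable
  show "AE \<omega> in N. 0 \<le> \<eta> i \<omega> ^ 4" by (simp add: zero_le_even_power)
qed

lemma variance_pos_if_unbounded: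
  assumes int: "integrable N (\<lambda>\<omega>. \<eta> i \<omega> ^ 4)" and pos: "prob {\<omega>\<in>space N. \<eta> i \<omega> > t} > 0" and t: "t > 0"
  shows "expectation (\<lambda>\<omega>. \<eta> i \<omega> ^ 2) > 0"
proof -
  let ?E = "{\<omega>\<in>space N. \<eta> i \<omega> > t}"
  have "0 < t\<^sup>2 * prob ?E" using pos t by simp
  also have "\<dots> = expectation (\<lambda>\<omega>. t\<^sup>2 * indicator ?E \<omega>)"
    by simp
  also have "\<dots> \<le> expectation (\<lambda>\<omega>. \<eta> i \<omega> ^ 2)"
  proof (rule integral_mono)
    show "integrable N (\<lambda>\<omega>. t\<^sup>2 * indicator ?E \<omega>)"
      by (intro integrable_mult_right integrable_real_indicator) (auto simp: emeasure_eq_measure)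
    show "integrable N (\<lambda>\<omega>. \<eta> i \<omega> ^ 2)" by (rule integrable_lower_power[OF _ int]) auto
    show "t\<^sup>2 * indicator ?E \<omega> \<le> \<eta> i \<omega> ^ 2" for \<omega>
      using t by (auto simp: indicator_def intro: power_mono)
  qed
  finally show ?thesis .
qed

end

section \<open>Oscillating and confined walks\<close>

lemma nn_steps_eq_image: "nn_steps = (\<lambda>(i, s). axis i s) ` (UNIV \<times> {1, -1 :: int})"
  by (auto simp: nn_steps_def)

lemma inj_on_nn_steps: "inj_on (\<lambda>(i, s). axis i s) (UNIV \<times> {1, -1 :: int})"
  by (auto simp: inj_on_def axis_eq_axis)

lemma finite_nn_steps [simp]: "finite nn_steps"
  by (simp add: nn_steps_eq_image)

lemma card_nn_steps: "card (nn_steps :: (int ^ 'd::finite) set) = 2 * CARD('d)"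
  unfolding nn_steps_eq_image by (subst card_image[OF inj_on_nn_steps]) (simp add: card_cartesian_product)

lemma sum_nn_steps: "(\<Sum>v\<in>nn_steps. f v) = (\<Sum>i\<in>UNIV. f (axis i 1) + f (axis i (-1)))"
  unfolding nn_steps_eq_image
  by (subst sum.reindex[OF inj_on_nn_steps]) (simp add: sum.cartesian_product' comp_def)

lemma nn_steps_nonempty [simp]: "nn_steps \<noteq> {}"
  by (auto simp: nn_steps_def)

lemma simple_random_walk_measurable [measurable_dest]:
  "simple_random_walk M S \<Longrightarrow> S k \<in> measurable M (count_space UNIV)"
  by (simp add: simple_random_walk_def)

lemma sets_walk_constraint:
  assumes "simple_random_walk M S"
  shows "{\<omega>\<in>space M. \<forall>k\<le>T. Q k (S k \<omega>)} \<in> sets M"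
proof -
  have [measurable]: "Measurable.pred M (\<lambda>\<omega>. Q k (S k \<omega>))" for k
    by (rule measurable_compose[OF simple_random_walk_measurable[OF assms]]) simp
  show ?thesis by measurable
qed

lemma prob_walk_steps:
  fixes S :: "nat \<Rightarrow> 'a \<Rightarrow> int ^ 'd::finite"
  assumes walk: "simple_random_walk M S" and vs: "set vs \<subseteq> nn_steps"
  shows "measure M {\<omega>\<in>space M. \<forall>k<length vs. S (Suc k) \<omega> - S k \<omega> = vs ! k} = (1 / (2 * CARD('d))) ^ length vs"
proof (cases "vs = []")
  case True
  interpret prob_space M using walk by (simp add: simple_random_walk_def)
  show ?thesis using True by (simp add: prob_space)
next
  case False
  interpret prob_space M using walk by (simp add: simple_random_walk_def)
  define Y where "Y = (\<lambda>k \<omega>. S (Suc k) \<omega> - S k \<omega>)"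
  have ind: "indep_vars (\<lambda>_. count_space UNIV) Y UNIV"
    and dist: "\<And>k. distr M (count_space UNIV) (Y k) = measure_pmf (pmf_of_set nn_steps)"
    using walk by (auto simp: simple_random_walk_def Y_def)
  have Y: "Y k \<in> measurable M (count_space UNIV)" for k using ind by (auto simp: indep_vars_def)
  have "{\<omega>\<in>space M. \<forall>k<length vs. S (Suc k) \<omega> - S k \<omega> = vs ! k}
      = (\<Inter>k\<in>{..<length vs}. Y k -` {vs ! k} \<inter> space M)"
    using False by (auto simp: Y_def)
  also have "prob \<dots> = (\<Prod>k\<in>{..<length vs}. prob (Y k -` {vs ! k} \<inter> space M))"
    using False by (intro indep_varsD[OF ind]) auto
  also have "\<dots> = (\<Prod>k\<in>{..<length vs}. 1 / (2 * CARD('d)))"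
  proof (rule prod.cong)
    fix k assume "k \<in> {..<length vs}"
    then have "vs ! k \<in> nn_steps" using vs by auto
    moreover have "prob (Y k -` {vs ! k} \<inter> space M) = measure (distr M (count_space UNIV) (Y k)) {vs ! k}"
      using Y by (simp add: measure_distr)
    ultimately show "prob (Y k -` {vs ! k} \<inter> space M) = 1 / (2 * CARD('d))"
      by (simp add: dist measure_pmf_single card_nn_steps)
  qed simp
  finally show ?thesis by simp
qed

text \<open>All sequences of T steps have the same probability and distinct ones give disjoint
  events, so lower bounds for the walk reduce to counting paths.\<close>

lemma prob_walk_paths:
  fixes S :: "nat \<Rightarrow> 'a \<Rightarrow> int ^ 'd::finite"
  assumes walk: "simple_random_walk M S"
    and W: "\<And>vs. vs \<in> W \<Longrightarrow> set vs \<subseteq> nn_steps \<and> length vs = T"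
  shows "card W * (1 / (2 * CARD('d))) ^ T
    \<le> measure M {\<omega>\<in>space M. \<exists>vs\<in>W. \<forall>k\<le>T. S k \<omega> = sum_list (take k vs)}"
proof -
  interpret prob_space M using walk by (simp add: simple_random_walk_def)
  have [measurable]: "S k \<in> measurable M (count_space UNIV)" for k
    using walk by (rule simple_random_walk_measurable)
  define E where "E vs = {\<omega>\<in>space M. \<forall>k<length vs. S (Suc k) \<omega> - S k \<omega> = vs ! k}" for vs
  have E_events: "E vs \<in> events" for vs unfolding E_def by measurable
  have "finite {vs. set vs \<subseteq> (nn_steps :: (int ^ 'd) set) \<and> length vs = T}" by (intro finite_lists_length_eq) simp
  then have fin: "finite W" by (rule finite_subset[rotated]) (use W in auto)
  have disj: "disjoint_family_on E W"
    unfolding disjoint_family_on_def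
  proof (intro ballI impI)
    fix us vs assume *: "us \<in> W" "vs \<in> W" "us \<noteq> vs"
    then obtain k where "k < T" "us ! k \<noteq> vs ! k" using W by (metis nth_equalityI)
    then show "E us \<inter> E vs = {}" using W * by (auto simp: E_def)
  qed
  have "card W * (1 / (2 * CARD('d))) ^ T = (\<Sum>vs\<in>W. prob (E vs))"
    unfolding E_def by (subst sum.cong[OF refl prob_walk_steps[OF walk]]) (use W in auto)
  also have "\<dots> = prob (\<Union>vs\<in>W. E vs)"
    using fin disj E_events by (intro finite_measure_finite_Union[symmetric]) auto
  also have "\<dots> \<le> prob {\<omega>\<in>space M. \<exists>vs\<in>W. \<forall>k\<le>T. S k \<omega> = sum_list (take k vs)}"
  proof (rule finite_measure_mono)
    have walk_eq: "S k \<omega> = sum_list (take k vs)" if "\<omega> \<in> E vs" "k \<le> length vs" for \<omega> k vs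
      using that(2)
    proof (induction k)
      case 0
      then show ?case using that(1) walk by (auto simp: simple_random_walk_def E_def)
    next
      case (Suc k)
      then have "S (Suc k) \<omega> = S k \<omega> + vs ! k" using that(1) by (auto simp: E_def algebra_simps)
      then show ?case using Suc by (simp add: take_Suc_conv_app_nth)
    qed
    show "(\<Union>vs\<in>W. E vs) \<subseteq> {\<omega>\<in>space M. \<exists>vs\<in>W. \<forall>k\<le>T. S k \<omega> = sum_list (take k vs)}"
    proof clarify
      fix \<omega> vs assume vs: "vs \<in> W" "\<omega> \<in> E vs"
      have "\<omega> \<in> space M" using vs(2) by (simp add: E_def)
      moreover have "length vs = T" using W vs(1) by blast
      then have "\<forall>k\<le>T. S k \<omega> = sum_list (take k vs)" using walk_eq[OF vs(2)] by blast
      ultimately show "\<omega> \<in> space M \<and> (\<exists>vs\<in>W. \<forall>k\<le>T. S k \<omega> = sum_list (take k vs))"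
        using vs(1) by blast
    qed
    show "{\<omega>\<in>space M. \<exists>vs\<in>W. \<forall>k\<le>T. S k \<omega> = sum_list (take k vs)} \<in> events"
      using fin by measurable
  qed
  finally show ?thesis .
qed

text \<open>A single path suffices: two opposite unit steps alternate, so every even partial sum is
  0.\<close>

lemma prob_walk_oscillates:
  fixes S :: "nat \<Rightarrow> 'a \<Rightarrow> int ^ 'd::finite"
  assumes walk: "simple_random_walk M S"
  shows "(1 / (2 * CARD('d))) ^ T \<le> measure M {\<omega>\<in>space M. \<forall>k\<le>T. even k \<longrightarrow> S k \<omega> = 0}"
proof -
  interpret prob_space M using walk by (simp add: simple_random_walk_def)
  have [measurable]: "S k \<in> measurable M (count_space UNIV)" for k
    using walk by (rule simple_random_walk_measurable)
  define i :: 'd where "i = undefined"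
  define f :: "nat \<Rightarrow> int ^ 'd" where "f k = (if even k then axis i 1 else axis i (-1))" for k
  define vs where "vs = map f [0..<T]"
  have "sum_list (map f [0..<k]) = (if even k then 0 else axis i 1)" for k
    by (induction k) (auto simp: f_def axis_def vec_eq_iff)
  then have sums: "sum_list (take k vs) = (if even k then 0 else axis i 1)" if "k \<le> T" for k
    using that by (simp add: vs_def take_map take_upt)
  have "card {vs} * (1 / (2 * CARD('d))) ^ T
      \<le> prob {\<omega>\<in>space M. \<exists>vs\<in>{vs}. \<forall>k\<le>T. S k \<omega> = sum_list (take k vs)}"
    by (rule prob_walk_paths[OF walk]) (auto simp: vs_def f_def nn_steps_def)
  also have "\<dots> \<le> prob {\<omega>\<in>space M. \<forall>k\<le>T. even k \<longrightarrow> S k \<omega> = 0}"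
    using sums by (intro finite_measure_mono) auto
  finally show ?thesis by simp
qed

section \<open>Counting the paths confined to a box\<close>

text \<open>The starting point is a parameter so that removing the first step gives a recursion. The
  case k = 0 makes the set empty when x lies outside the box.\<close>

definition confined_paths :: "nat \<Rightarrow> nat \<Rightarrow> int ^ 'd::finite \<Rightarrow> (int ^ 'd) list set" where
  "confined_paths r T x =
     {vs. set vs \<subseteq> nn_steps \<and> length vs = T \<and> (\<forall>k\<le>T. \<forall>i. \<bar>(x + sum_list (take k vs)) $ i\<bar> \<le> int r)}"

lemma finite_confined_paths [simp]: "finite (confined_paths r T x)"
  by (rule finite_subset[OF _ finite_lists_length_eq[OF finite_nn_steps, of T]])
    (auto simp: confined_paths_def)

definition cos_profile :: "real \<Rightarrow> int ^ 'd::finite \<Rightarrow> real" where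
  "cos_profile a x = (\<Prod>i\<in>UNIV. cos (a * of_int (x $ i)))"

text \<open>The addition formula for the cosine in one coordinate. Summed over the axes it gives the
  eigenvalue 2 d cos a of the sum over neighbours.\<close>

lemma cos_profile_axis_sum:
  "cos_profile a (x + axis i 1) + cos_profile a (x + axis i (-1)) = 2 * cos a * cos_profile a x"
proof -
  have *: "cos_profile a (x + axis i s) = cos (a * of_int (x $ i + s)) * (\<Prod>j\<in>UNIV - {i}. cos (a * of_int (x $ j)))" for s
    unfolding cos_profile_def
    by (subst prod.remove[of _ i]) (auto simp: axis_def intro!: prod.cong)
  have "cos_profile a x = cos (a * of_int (x $ i)) * (\<Prod>j\<in>UNIV - {i}. cos (a * of_int (x $ j)))"
    unfolding cos_profile_def by (subst prod.remove[of _ i]) auto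
  then show ?thesis
    unfolding * by (simp add: distrib_left right_diff_distrib cos_add cos_diff algebra_simps)
qed

text \<open>The product of cosines vanishes just outside the box and is an eigenfunction of the walk, so it
  is a lower solution of the recursion satisfied by the number of confined paths.\<close>

lemma card_confined_paths:
  fixes x :: "int ^ 'd::finite" and r :: nat
  defines "a \<equiv> pi / (2 * (real r + 1))"
  assumes "\<And>i. \<bar>x $ i\<bar> \<le> int r"
  shows "(2 * real CARD('d) * cos a) ^ T * cos_profile a x \<le> card (confined_paths r T x)"
  using assms(2)
proof (induction T arbitrary: x)
  case 0
  have "cos_profile a x \<le> \<bar>cos_profile a x\<bar>" by simp
  also have "\<dots> \<le> 1" unfolding cos_profile_def abs_prod by (intro prod_le_1) auto
  finally have "cos_profile a x \<le> 1" .
  moreover have "confined_paths r 0 x = {[]}" using 0 by (auto simp: confined_paths_def)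
  ultimately show ?case by simp
next
  case (Suc T)
  \<comment> \<open>The induction hypothesis covers only starting points in the box. A neighbour
    outside has a coordinate of absolute value exactly r + 1, where the angle is pi / 2 in absolute
    value and the profile is 0.\<close>
  have step: "(2 * real CARD('d) * cos a) ^ T * cos_profile a (x + v) \<le> card (confined_paths r T (x + v))"
    if v: "v \<in> nn_steps" for v
  proof (cases "\<forall>i. \<bar>(x + v) $ i\<bar> \<le> int r")
    case True
    then show ?thesis using Suc.IH by blast
  next
    case False
    then obtain i where i: "\<bar>(x + v) $ i\<bar> > int r" by (metis linorder_not_le)
    have "\<bar>v $ i\<bar> \<le> 1" using v by (auto simp: nn_steps_def axis_def)
    then have "\<bar>(x + v) $ i\<bar> = int r + 1" using i Suc.prems[of i] by auto
    then have "\<bar>real_of_int ((x + v) $ i)\<bar> = real r + 1" by (simp flip: of_int_abs)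
    then have "\<bar>a * of_int ((x + v) $ i)\<bar> = pi / 2"
      unfolding abs_mult by (simp add: a_def field_simps)
    then have "a * of_int ((x + v) $ i) = pi / 2 \<or> a * of_int ((x + v) $ i) = - (pi / 2)" by linarith
    then have "cos (a * of_int ((x + v) $ i)) = 0" by (metis cos_minus cos_pi_half)
    then have "cos_profile a (x + v) = 0" by (auto simp: cos_profile_def)
    then show ?thesis by simp
  qed
  have "(2 * real CARD('d) * cos a) ^ Suc T * cos_profile a x
      = (2 * real CARD('d) * cos a) ^ T * (\<Sum>v\<in>nn_steps. cos_profile a (x + v))"
    by (simp add: sum_nn_steps cos_profile_axis_sum)
  also have "\<dots> \<le> (\<Sum>v\<in>nn_steps. real (card (confined_paths r T (x + v))))"
    unfolding sum_distrib_left by (intro sum_mono step)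
  also have "\<dots> = card (\<Union>v\<in>nn_steps. (#) v ` confined_paths r T (x + v))"
    by (subst card_UN_disjoint) (auto simp: card_image)
  also have "\<dots> \<le> card (confined_paths r (Suc T) x)"
  proof (intro of_nat_mono card_mono)
    show "(\<Union>v\<in>nn_steps. (#) v ` confined_paths r T (x + v)) \<subseteq> confined_paths r (Suc T) x"
    proof clarsimp
      fix v :: "int ^ 'd" and us assume v: "v \<in> nn_steps" and us: "us \<in> confined_paths r T (x + v)"
      have "\<bar>(x + sum_list (take k (v # us))) $ i\<bar> \<le> int r" if "k \<le> Suc T" for k i
        using that us Suc.prems by (cases k) (auto simp: confined_paths_def add.assoc)
      then show "v # us \<in> confined_paths r (Suc T) x"
        using v us by (auto simp: confined_paths_def)
    qed
  qed simp
  finally show ?case .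
qed

text \<open>At the origin the profile is 1, and the factors 2 d of the path count cancel against the
  path probabilities.\<close>

lemma prob_walk_confined:
  fixes S :: "nat \<Rightarrow> 'a \<Rightarrow> int ^ 'd::finite"
  assumes walk: "simple_random_walk M S"
  shows "cos (pi / (2 * (real r + 1))) ^ T \<le> measure M {\<omega>\<in>space M. \<forall>k\<le>T. \<forall>i. \<bar>S k \<omega> $ i\<bar> \<le> int r}"
proof -
  interpret prob_space M using walk by (simp add: simple_random_walk_def)
  let ?a = "pi / (2 * (real r + 1))"
  have "cos ?a ^ T = (2 * real CARD('d) * cos ?a) ^ T * cos_profile ?a (0 :: int ^ 'd) * (1 / (2 * CARD('d))) ^ T"
    by (simp add: cos_profile_def power_mult_distrib[symmetric])
  also have "\<dots> \<le> card (confined_paths r T (0 :: int ^ 'd)) * (1 / (2 * CARD('d))) ^ T"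
    by (intro mult_right_mono card_confined_paths) auto
  also have "\<dots> \<le> prob {\<omega>\<in>space M. \<exists>vs\<in>confined_paths r T (0 :: int ^ 'd). \<forall>k\<le>T. S k \<omega> = sum_list (take k vs)}"
    by (rule prob_walk_paths[OF walk]) (auto simp: confined_paths_def)
  also have "\<dots> \<le> prob {\<omega>\<in>space M. \<forall>k\<le>T. \<forall>i. \<bar>S k \<omega> $ i\<bar> \<le> int r}"
  proof (rule finite_measure_mono)
    have "\<forall>k\<le>T. \<forall>i. \<bar>S k \<omega> $ i\<bar> \<le> int r"
      if vs: "vs \<in> confined_paths r T (0 :: int ^ 'd)" and S: "\<forall>k\<le>T. S k \<omega> = sum_list (take k vs)" for \<omega> vs
    proof -
      have "\<forall>k\<le>T. \<forall>i. \<bar>sum_list (take k vs) $ i\<bar> \<le> int r"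
        using vs unfolding confined_paths_def by simp
      then show ?thesis using S by simp
    qed
    then show "{\<omega>\<in>space M. \<exists>vs\<in>confined_paths r T (0 :: int ^ 'd). \<forall>k\<le>T. S k \<omega> = sum_list (take k vs)}
      \<subseteq> {\<omega>\<in>space M. \<forall>k\<le>T. \<forall>i. \<bar>S k \<omega> $ i\<bar> \<le> int r}" by blast
  qed (rule sets_walk_constraint[OF walk])
  finally show ?thesis .
qed

section \<open>Conditioning on the walk\<close>

lemma measurable_rwrs:
  assumes walk: "simple_random_walk M S" and \<eta>: "\<And>x. \<eta> x \<in> borel_measurable N"
  shows "rwrs S \<eta> n \<in> borel_measurable (M \<Otimes>\<^sub>M N)"
proof -
  have "(\<lambda>\<omega>. \<eta> (S k (fst \<omega>)) (snd \<omega>)) \<in> borel_measurable (M \<Otimes>\<^sub>M N)" for k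
  proof (rule measurable_compose_countable)
    show "(\<lambda>\<omega>. S k (fst \<omega>)) \<in> measurable (M \<Otimes>\<^sub>M N) (count_space UNIV)"
      by (rule measurable_compose[OF measurable_fst simple_random_walk_measurable[OF walk]])
    show "(\<lambda>\<omega>. \<eta> x (snd \<omega>)) \<in> borel_measurable (M \<Otimes>\<^sub>M N)" for x
      by (rule measurable_compose[OF measurable_snd \<eta>])
  qed
  then show ?thesis unfolding rwrs_def[abs_def] by measurable
qed

text \<open>Fubini: the conditional scenery probability is integrated over the walk, keeping only
  the paths in A.\<close>

lemma prob_rwrs_ge_by_conditioning:
  assumes walk: "simple_random_walk M S" and N: "prob_space N" and \<eta>: "\<And>x. \<eta> x \<in> borel_measurable N"
    and A: "A \<in> sets M" and "b \<ge> 0"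
    and cond: "\<And>\<omega>. \<omega> \<in> A \<Longrightarrow> b \<le> measure N {\<xi>\<in>space N. (\<Sum>k=0..n. \<eta> (S k \<omega>) \<xi>) \<ge> t}"
  shows "measure M A * b \<le> measure (M \<Otimes>\<^sub>M N) {\<omega>\<in>space (M \<Otimes>\<^sub>M N). rwrs S \<eta> n \<omega> \<ge> t}"
proof -
  interpret M: prob_space M using walk by (simp add: simple_random_walk_def)
  interpret N: prob_space N by (rule N)
  interpret pair_prob_space M N ..
  note [measurable] = measurable_rwrs[of M S \<eta> N n, OF walk \<eta>]
  let ?E = "{\<omega>\<in>space (M \<Otimes>\<^sub>M N). rwrs S \<eta> n \<omega> \<ge> t}"
  have E: "?E \<in> sets (M \<Otimes>\<^sub>M N)" by measurable
  have "ennreal (measure M A * b) = (\<integral>\<^sup>+\<omega>. ennreal b * indicator A \<omega> \<partial>M)"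
    using A \<open>b \<ge> 0\<close> by (simp add: nn_integral_cmult_indicator M.emeasure_eq_measure ennreal_mult mult.commute)
  also have "\<dots> \<le> (\<integral>\<^sup>+\<omega>. emeasure N (Pair \<omega> -` ?E) \<partial>M)"
  proof (rule nn_integral_mono)
    fix \<omega> assume w: "\<omega> \<in> space M"
    have "Pair \<omega> -` ?E = {\<xi>\<in>space N. (\<Sum>k=0..n. \<eta> (S k \<omega>) \<xi>) \<ge> t}"
      using w by (auto simp: rwrs_def space_pair_measure)
    then show "ennreal b * indicator A \<omega> \<le> emeasure N (Pair \<omega> -` ?E)"
      using cond[of \<omega>] by (auto simp: N.emeasure_eq_measure indicator_def intro!: ennreal_leI)
  qed
  also have "\<dots> = emeasure (M \<Otimes>\<^sub>M N) ?E"
    by (rule N.emeasure_pair_measure_alt[OF E, symmetric])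
  also have "\<dots> = ennreal (measure (M \<Otimes>\<^sub>M N) ?E)"
    by (rule P.emeasure_eq_measure)
  finally show ?thesis by simp
qed

section \<open>The three lower bounds\<close>

definition local_time :: "(nat \<Rightarrow> 'i) \<Rightarrow> nat \<Rightarrow> 'i \<Rightarrow> real" where
  "local_time s n x = real (card {k\<in>{0..n}. s k = x})"

lemma local_time_nonneg [simp]: "0 \<le> local_time s n x"
  by (simp add: local_time_def)

lemma local_time_mono: "m \<le> n \<Longrightarrow> local_time s m x \<le> local_time s n x"
  unfolding local_time_def by (intro of_nat_mono card_mono) auto

lemma local_time_ge_1: "x \<in> s ` {0..n} \<Longrightarrow> 1 \<le> local_time s n x"
proof -
  assume "x \<in> s ` {0..n}"
  then have "{k\<in>{0..n}. s k = x} \<noteq> {}" by auto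
  then have "card {k\<in>{0..n}. s k = x} > 0" by (subst card_gt_0_iff) auto
  then show ?thesis by (simp add: local_time_def)
qed

lemma sum_local_time:
  assumes "finite F" "s ` {0..n} \<subseteq> F"
  shows "sum (local_time s n) F = real n + 1"
  using sum_fun_comp[of "{0..n}" F s "\<lambda>_. 1 :: real"] assms by (simp add: local_time_def)

text \<open>F may exceed the range, since unvisited sites have local time 0. It can therefore
  contain the sites favoured by a strategy, visited or not.\<close>

lemma (in symmetric_iid) path_sum_eq_wsum:
  assumes "finite F" "s ` {0..n} \<subseteq> F"
  shows "(\<Sum>k=0..n. \<eta> (s k) \<omega>) = wsum (local_time s n) F \<omega>"
  using sum_fun_comp[of "{0..n}" F s "\<lambda>x. \<eta> x \<omega>"] assms by (simp add: local_time_def wsum_def)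

section \<open>Comparison of costs, and Region I for a fixed path\<close>

text \<open>Bookkeeping for all regions: the factor 1/2 and the base p become one constant in front
  of z. The factor 1/2 is absorbed because z \<ge> 1.\<close>

lemma exp_le_half_mult_powr:
  fixes p q z u :: real
  assumes "0 < p" "p \<le> 1" "u \<le> K * z" "1 \<le> z"
  shows "exp (- (ln 2 - K * ln p) * z) \<le> p powr u / 2"
proof -
  have "ln 2 * 1 \<le> ln 2 * z" using assms by (intro mult_left_mono) auto
  then have "exp (- (ln 2 * z)) \<le> exp (- ln 2 :: real)" by simp
  also have "\<dots> = 1 / 2" by (simp add: exp_minus)
  finally have 1: "exp (- (ln 2 * z)) \<le> 1 / 2" .
  have "K * z * ln p \<le> u * ln p" using assms by (intro mult_right_mono_neg) auto
  then have 2: "exp (K * z * ln p) \<le> p powr u" using assms by (simp add: powr_def)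
  have "exp (- (ln 2 - K * ln p) * z) = exp (K * z * ln p) * exp (- (ln 2 * z))"
    by (simp add: exp_add[symmetric] algebra_simps)
  also have "\<dots> \<le> p powr u * (1 / 2)" using 1 2 by (intro mult_mono) auto
  finally show ?thesis by simp
qed

text \<open>The block argument needs m to be at least 1.  Otherwise n is at most a multiple of itself to the
  power 2 beta - 1, and it suffices that the scenery is at least y on the whole range.\<close>

lemma (in symmetric_iid) prob_path_sum_region1:
  fixes \<beta> y :: real
  assumes \<theta>: "\<theta> > 0" and p: "p > 0"
    and pz: "\<And>B w. finite B \<Longrightarrow> prob {\<omega>\<in>space N. wsum w B \<omega> \<ge> \<theta> * sqrt (\<Sum>x\<in>B. (w x)\<^sup>2)} \<ge> p"
    and q: "prob {\<omega>\<in>space N. \<eta> i \<omega> \<ge> y} > 0"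
    and \<beta>: "1/2 < \<beta>" "\<beta> \<le> 1" and y: "y > 0"
  shows "\<exists>c>0. \<forall>n\<ge>1. \<forall>s. exp (- c * real n powr (2 * \<beta> - 1))
    \<le> prob {\<omega>\<in>space N. (\<Sum>k=0..n. \<eta> (s k) \<omega>) \<ge> real n powr \<beta> * y}"
proof -
  define q where "q = prob {\<omega>\<in>space N. \<eta> i \<omega> \<ge> y}"
  \<comment> \<open>The bound \<epsilon> \<le> 1/2 will give m \<le> n/2, and 4 y \<epsilon> \<le>
    \<theta> will make the total contribution \<theta> (n/2) / (2 sqrt m) at least y
    n^\<beta>.\<close>
  define \<epsilon> where "\<epsilon> = min (1 / 2) (\<theta> / (4 * y))"
  have \<epsilon>: "0 < \<epsilon>" "\<epsilon> \<le> 1 / 2" "4 * y * \<epsilon> \<le> \<theta>" using \<theta> y by (auto simp: \<epsilon>_def min_def field_simps)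
  have "\<epsilon> * \<epsilon> \<le> 1 * (1 / 2)" using \<epsilon> by (intro mult_mono) auto
  then have \<epsilon>2: "0 < \<epsilon>\<^sup>2" "\<epsilon>\<^sup>2 \<le> 1 / 2" using \<epsilon> by (auto simp: power2_eq_square)
  have p1: "p \<le> 1" using pz[of "{}" "\<lambda>_. 0"] prob_le_1 order_trans by blast
  have q01: "0 < q" "q \<le> 1" using q by (auto simp: q_def)
  \<comment> \<open>With m and z as below, the total local time is n + 1 \<le> 2 n and n/m = z /
    \<epsilon>^2, so K z bounds the number of blocks. It also bounds the size of the range when m <
    1.\<close>
  define K where "K = 2 / \<epsilon>\<^sup>2"
  have K: "K > 0" using \<epsilon>2 by (simp add: K_def)
  define c where "c = ln 2 - K * ln p - K * ln q"
  have lnp: "K * ln p \<le> 0" "K * ln q \<le> 0" using K p p1 q01 by (auto intro!: mult_nonneg_nonpos)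
  have "ln (2 :: real) > 0" by simp
  then have c: "c > 0" using lnp unfolding c_def by linarith
  have "exp (- c * real n powr (2 * \<beta> - 1))
    \<le> prob {\<omega>\<in>space N. (\<Sum>k=0..n. \<eta> (s k) \<omega>) \<ge> real n powr \<beta> * y}" if n: "n \<ge> 1" for n s
  proof -
    let ?F = "s ` {0..n}" and ?l = "local_time s n"
    define z where "z = real n powr (2 * \<beta> - 1)"
    define m where "m = \<epsilon>\<^sup>2 * real n powr (2 - 2 * \<beta>)"
    have z1: "z \<ge> 1" unfolding z_def using n \<beta> by (intro ge_one_powr_ge_zero) auto
    have nz: "real n powr (2 - 2 * \<beta>) * z = real n"
      using n by (simp add: z_def powr_add[symmetric])
    have nb: "real n powr \<beta> \<le> real n"
      using powr_mono[of \<beta> 1 "real n"] n \<beta> by simp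
    have m0: "m > 0" using \<epsilon>2 n by (simp add: m_def)
    have eq: "(\<Sum>k=0..n. \<eta> (s k) \<omega>) = wsum ?l ?F \<omega>" for \<omega> by (rule path_sum_eq_wsum) auto
    have sl: "sum ?l ?F = real n + 1" by (rule sum_local_time) auto
    show ?thesis
    proof (cases "m \<ge> 1")
      case True
      have "real n powr (2 - 2 * \<beta>) \<le> real n powr 1" using n \<beta> by (intro powr_mono) auto
      then have "m \<le> 1 / 2 * real n" unfolding m_def using \<epsilon>2 n by (intro mult_mono) auto
      then have mn: "real n / 2 \<le> real n + 1 - m" by simp
      have "sqrt m = \<epsilon> * real n powr (1 - \<beta>)"
      proof (rule real_sqrt_unique)
        show "(\<epsilon> * real n powr (1 - \<beta>))\<^sup>2 = m"
          using n by (simp add: m_def power_mult_distrib powr_power)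
      qed (use \<epsilon> in auto)
      then have "real n powr \<beta> * y * (2 * sqrt m) = 2 * (y * \<epsilon>) * real n"
        using n by (simp add: powr_add[symmetric] mult_ac)
      also have "\<dots> \<le> \<theta> * (real n / 2)" using \<epsilon>(3) n mult_right_mono[of "4 * y * \<epsilon>" \<theta> "real n"] by simp
      also have "\<dots> \<le> \<theta> * (real n + 1 - m)" using mn \<theta> by (intro mult_left_mono) auto
      finally have thr: "real n powr \<beta> * y \<le> \<theta> * (sum ?l ?F - m) / (2 * sqrt m)"
        unfolding sl using m0 by (simp add: pos_le_divide_eq)
      have "sum ?l ?F / m \<le> 2 * real n / m" unfolding sl using n m0 by (intro divide_right_mono) auto
      also have "\<dots> = K * z" using n m0 \<epsilon>2 nz[symmetric] by (simp add: K_def m_def field_simps)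
      finally have "exp (- (ln 2 - K * ln p) * z) \<le> p powr (sum ?l ?F / m) / 2"
        using p p1 z1 by (intro exp_le_half_mult_powr) auto
      moreover have "exp (- c * z) \<le> exp (- (ln 2 - K * ln p) * z)"
        unfolding exp_le_cancel_iff using lnp z1 by (intro mult_right_mono) (auto simp: c_def)
      moreover have "p powr (sum ?l ?F / m) / 2 \<le> prob {\<omega>\<in>space N. wsum ?l ?F \<omega> \<ge> \<theta> * (sum ?l ?F - m) / (2 * sqrt m)}"
        using True by (intro prob_wsum_blocks[OF \<theta> p pz]) (auto intro: local_time_ge_1)
      moreover have "\<dots> \<le> prob {\<omega>\<in>space N. wsum ?l ?F \<omega> \<ge> real n powr \<beta> * y}"
        using thr by (intro finite_measure_mono) auto
      ultimately show ?thesis unfolding eq z_def[symmetric] by linarith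
    next
      case False
      have "card ?F \<le> n + 1" using card_image_le[of "{0..n}" s] by simp
      then have "real (card ?F) \<le> 2 * real n" using n by simp
      also have "\<dots> \<le> K * z"
      proof -
        have "\<epsilon>\<^sup>2 * real n = m * z" using nz by (simp add: m_def)
        also have "\<dots> \<le> 1 * z" using False z1 by (intro mult_right_mono) auto
        finally show ?thesis using \<epsilon>2 by (simp add: K_def field_simps)
      qed
      finally have "exp (- (ln 2 - K * ln q) * z) \<le> q powr (card ?F) / 2"
        using q01 z1 by (intro exp_le_half_mult_powr) auto
      also have "\<dots> \<le> q ^ card ?F" using q01 by (simp add: powr_realpow)
      also have "\<dots> \<le> prob {\<omega>\<in>space N. wsum ?l ?F \<omega> \<ge> y * sum ?l ?F}"
        unfolding q_def by (intro prob_wsum_ge_const) auto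
      also have "\<dots> \<le> prob {\<omega>\<in>space N. wsum ?l ?F \<omega> \<ge> real n powr \<beta> * y}"
      proof (intro finite_measure_mono)
        have "real n powr \<beta> * y \<le> y * sum ?l ?F"
          unfolding sl using nb y by (subst mult.commute) (intro mult_left_mono, auto)
        then show "{\<omega>\<in>space N. wsum ?l ?F \<omega> \<ge> y * sum ?l ?F} \<subseteq> {\<omega>\<in>space N. wsum ?l ?F \<omega> \<ge> real n powr \<beta> * y}"
          by auto
      qed auto
      finally have "exp (- (ln 2 - K * ln q) * z) \<le> prob {\<omega>\<in>space N. wsum ?l ?F \<omega> \<ge> real n powr \<beta> * y}" .
      moreover have "exp (- c * z) \<le> exp (- (ln 2 - K * ln q) * z)"
        unfolding exp_le_cancel_iff using lnp z1 by (intro mult_right_mono) (auto simp: c_def)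
      ultimately show ?thesis unfolding eq z_def[symmetric] by linarith
    qed
  qed
  then show ?thesis using c by blast
qed

section \<open>Region II: the tail at every level, and oscillation\<close>

text \<open>Below the threshold \<open>t0\<close> of the asymptotic bound, monotonicity allows t to
  be replaced by \<open>t0\<close>; K and the summand 1 absorb the difference.\<close>

lemma tail_lower_bound:
  assumes "has_tail_exponent N X \<alpha>" and "\<alpha> \<ge> 1" and "prob_space N" and [measurable]: "X \<in> borel_measurable N"
  obtains K where "K > 0" "\<And>t. t \<ge> 0 \<Longrightarrow> exp (- K * (1 + t powr \<alpha>)) \<le> measure N {\<omega>\<in>space N. X \<omega> \<ge> t}"
proof -
  interpret prob_space N by fact
  obtain c t0 where c: "c > 0" and t0: "t0 \<ge> 1"
    and lb: "\<And>t. t \<ge> t0 \<Longrightarrow> exp (- 2 * c * t powr \<alpha>) \<le> prob {\<omega>\<in>space N. X \<omega> > t}"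
    using has_tail_exponent_bounds[OF assms(1,2)] by metis
  define K where "K = 2 * c * (1 + t0 powr \<alpha>)"
  have "K > 0" unfolding K_def using c by (intro mult_pos_pos add_pos_nonneg) auto
  moreover have "exp (- K * (1 + t powr \<alpha>)) \<le> prob {\<omega>\<in>space N. X \<omega> \<ge> t}" if t: "t \<ge> 0" for t
  proof -
    define s where "s = max t t0"
    have "s powr \<alpha> \<le> t powr \<alpha> + t0 powr \<alpha>" by (simp add: s_def max_def)
    also have "\<dots> \<le> (1 + t0 powr \<alpha>) * (1 + t powr \<alpha>)" by (simp add: algebra_simps)
    finally have "2 * c * s powr \<alpha> \<le> 2 * c * ((1 + t0 powr \<alpha>) * (1 + t powr \<alpha>))"
      using c by (intro mult_left_mono) auto
    then have "exp (- K * (1 + t powr \<alpha>)) \<le> exp (- 2 * c * s powr \<alpha>)"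
      by (simp add: K_def mult.assoc)
    also have "\<dots> \<le> prob {\<omega>\<in>space N. X \<omega> > s}" by (intro lb) (simp add: s_def)
    also have "\<dots> \<le> prob {\<omega>\<in>space N. X \<omega> \<ge> t}" by (intro finite_measure_mono) (auto simp: s_def)
    finally show ?thesis .
  qed
  ultimately show ?thesis using that by blast
qed

lemma prob_ge_pos_if_tail_exponent:
  assumes "has_tail_exponent N X \<alpha>" "\<alpha> \<ge> 1" "prob_space N" "X \<in> borel_measurable N" "y \<ge> 0"
  shows "0 < measure N {\<omega>\<in>space N. X \<omega> \<ge> y}"
proof -
  obtain K where "\<And>t. t \<ge> 0 \<Longrightarrow> exp (- K * (1 + t powr \<alpha>)) \<le> measure N {\<omega>\<in>space N. X \<omega> \<ge> t}"
    using tail_lower_bound[OF assms(1-4)] by metis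
  from less_le_trans[OF exp_gt_zero this[OF assms(5)]] show ?thesis .
qed

text \<open>Joins a cost given as a power of p with a cost u already bounded by an exponential. In
  Region II the power belongs to the walk and u to the scenery; in Region III the roles are
  exchanged.\<close>

lemma exp_le_power_mult:
  fixes u z a b :: real
  assumes "0 < p" "p \<le> 1" "real T \<le> a * z" "1 \<le> z" "exp (- b * z) \<le> u"
  shows "exp (- (ln 2 - a * ln p + b) * z) \<le> p ^ T * (u / 2)"
proof -
  have "exp (- (ln 2 - a * ln p + b) * z) = exp (- (ln 2 - a * ln p) * z) * exp (- b * z)"
    by (simp add: exp_add[symmetric] algebra_simps)
  also have "\<dots> \<le> p powr (real T) / 2 * u"
    using assms by (intro mult_mono exp_le_half_mult_powr) auto
  finally show ?thesis using assms by (simp add: powr_realpow)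
qed

lemma rwrs_lower_bound_region2:
  fixes S :: "nat \<Rightarrow> 'a \<Rightarrow> int ^ 'd::finite"
  assumes walk: "simple_random_walk M S" and scenery: "symmetric_iid N \<eta>"
    and tail: "has_tail_exponent N (\<eta> 0) \<alpha>" and \<alpha>: "\<alpha> > 1"
    and \<beta>: "0 \<le> \<beta>" "\<beta> \<le> 1 + 1 / \<alpha>" and y: "y > 0"
  shows "\<exists>c>0. \<forall>n\<ge>1. exp (- c * real n powr (\<beta> * \<alpha> / (\<alpha> + 1)))
     \<le> measure (M \<Otimes>\<^sub>M N) {\<omega>\<in>space (M \<Otimes>\<^sub>M N). rwrs S \<eta> n \<omega> \<ge> real n powr \<beta> * y}"
proof -
  interpret symmetric_iid N \<eta> by fact
  \<comment> \<open>The common exponent of T and t^\<alpha>. The hypothesis \<beta> \<le> 1 +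
    1/\<alpha> is equivalent to \<gamma> \<le> 1, so the oscillation fits into n steps.\<close>
  define \<gamma> where "\<gamma> = \<beta> * \<alpha> / (\<alpha> + 1)"
  have "\<beta> * \<alpha> \<le> (1 + 1 / \<alpha>) * \<alpha>" using \<beta> \<alpha> by (intro mult_right_mono) auto
  then have \<gamma>: "0 \<le> \<gamma>" "\<gamma> \<le> 1" using \<beta> \<alpha> by (auto simp: \<gamma>_def field_simps)
  have "\<beta> / (\<alpha> + 1) + \<gamma> = \<beta> * (\<alpha> + 1) / (\<alpha> + 1)"
    unfolding \<gamma>_def add_divide_distrib[symmetric] by (simp add: distrib_left add.commute)
  then have \<gamma>\<beta>: "\<beta> / (\<alpha> + 1) + \<gamma> = \<beta>" "\<beta> / (\<alpha> + 1) * \<alpha> = \<gamma>" using \<alpha> by (auto simp: \<gamma>_def)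
  obtain K where K: "K > 0"
    and tl: "\<And>t. t \<ge> 0 \<Longrightarrow> exp (- K * (1 + t powr \<alpha>)) \<le> prob {\<omega>\<in>space N. \<eta> 0 \<omega> \<ge> t}"
    using tail_lower_bound[OF tail _ prob_space_axioms random_variable_scenery] \<alpha> by (metis less_imp_le)
  define p :: real where "p = 1 / (2 * CARD('d))"
  have "CARD('d) \<ge> 1" by (simp add: Suc_leI)
  then have "1 \<le> 2 * real CARD('d)" by linarith
  then have p: "0 < p" "p \<le> 1" by (simp_all add: p_def)
  define b where "b = K * (1 + (2 * y) powr \<alpha>)"
  have b: "b > 0" unfolding b_def using K by (intro mult_pos_pos add_pos_nonneg) auto
  define c where "c = ln 2 - 1 * ln p + b"
  have "ln p \<le> 0" "ln (2 :: real) > 0" using p by auto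
  then have c: "c > 0" using b unfolding c_def by linarith
  have "exp (- c * real n powr \<gamma>)
     \<le> measure (M \<Otimes>\<^sub>M N) {\<omega>\<in>space (M \<Otimes>\<^sub>M N). rwrs S \<eta> n \<omega> \<ge> real n powr \<beta> * y}" if n: "n \<ge> 1" for n
  proof -
    define z where "z = real n powr \<gamma>"
    define T where "T = nat \<lfloor>z\<rfloor>"
    \<comment> \<open>The factor 2 compensates for the origin being occupied only at even
      times.\<close>
    define t where "t = 2 * y * real n powr (\<beta> / (\<alpha> + 1))"
    have z: "1 \<le> z" "z \<le> real n"
      using n \<gamma> powr_mono[of \<gamma> 1 "real n"] by (auto simp: z_def ge_one_powr_ge_zero)
    have T: "real T \<le> z" "z \<le> real T + 1" using z unfolding T_def by linarith+
    have Tn: "T \<le> n" using T z by linarith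
    have t: "t \<ge> 0" using y by (simp add: t_def)
    have ta: "t powr \<alpha> = (2 * y) powr \<alpha> * z"
      using y \<gamma>\<beta> by (simp add: t_def z_def powr_mult powr_powr)
    define A where "A = {\<omega>\<in>space M. \<forall>k\<le>T. even k \<longrightarrow> S k \<omega> = 0}"
    define u where "u = prob {\<xi>\<in>space N. \<eta> 0 \<xi> \<ge> t}"
    have "exp (- b * z) \<le> exp (- K * (1 + t powr \<alpha>))"
    proof -
      have "1 + t powr \<alpha> \<le> (1 + (2 * y) powr \<alpha>) * z" using z by (simp add: ta algebra_simps)
      then have "K * (1 + t powr \<alpha>) \<le> K * ((1 + (2 * y) powr \<alpha>) * z)" using K by (intro mult_left_mono) auto
      then show ?thesis by (simp add: b_def mult.assoc)
    qed
    also have "\<dots> \<le> u" unfolding u_def by (rule tl[OF t])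
    finally have u: "exp (- b * z) \<le> u" .
    have "exp (- c * z) \<le> p ^ T * (u / 2)"
      unfolding c_def using p T z u by (intro exp_le_power_mult) auto
    also have "\<dots> \<le> measure M A * (u / 2)"
      unfolding A_def p_def by (intro mult_right_mono prob_walk_oscillates[OF walk]) (simp add: u_def)
    also have "\<dots> \<le> measure (M \<Otimes>\<^sub>M N) {\<omega>\<in>space (M \<Otimes>\<^sub>M N). rwrs S \<eta> n \<omega> \<ge> real n powr \<beta> * y}"
    proof (rule prob_rwrs_ge_by_conditioning[OF walk prob_space_axioms random_variable_scenery])
      show "A \<in> sets M"
        unfolding A_def by (rule sets_walk_constraint[OF walk, of T "\<lambda>k x. even k \<longrightarrow> x = 0"])
      show "0 \<le> u / 2" by (simp add: u_def)
      fix \<omega> assume w: "\<omega> \<in> A"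
      let ?s = "\<lambda>k. S k \<omega>"
      let ?l = "local_time ?s n" and ?F = "?s ` {0..n}"
      \<comment> \<open>Counting time 0, the even times give \<open>T div 2 + 1\<close> visits;
        twice this is at least T + 1, hence at least z.\<close>
      have "(\<lambda>j. 2 * j) ` {0..T div 2} \<subseteq> {k\<in>{0..n}. ?s k = 0}"
        using w Tn by (auto simp: A_def)
      then have "card ((\<lambda>j. 2 * j) ` {0..T div 2}) \<le> card {k\<in>{0..n}. ?s k = 0}"
        by (intro card_mono) auto
      then have "T div 2 + 1 \<le> card {k\<in>{0..n}. ?s k = 0}"
        by (subst (asm) card_image) (auto simp: inj_on_def)
      then have "real T + 1 \<le> 2 * ?l 0" unfolding local_time_def by linarith
      then have l0: "z / 2 \<le> ?l 0" using T by simp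
      have "real n powr \<beta> = real n powr (\<beta> / (\<alpha> + 1)) * z"
        unfolding z_def powr_add[symmetric] \<gamma>\<beta>(1) ..
      then have "real n powr \<beta> * y = z / 2 * t" by (simp add: t_def)
      also have "\<dots> \<le> ?l 0 * t" using l0 t by (intro mult_right_mono)
      finally have thr: "real n powr \<beta> * y \<le> ?l 0 * t" .
      have "u \<le> prob {\<xi>\<in>space N. wsum ?l {0} \<xi> \<ge> real n powr \<beta> * y}"
        unfolding u_def
      proof (rule finite_measure_mono, clarify)
        fix \<xi> assume "t \<le> \<eta> 0 \<xi>"
        then have "?l 0 * t \<le> ?l 0 * \<eta> 0 \<xi>" by (intro mult_left_mono) auto
        then show "real n powr \<beta> * y \<le> wsum ?l {0} \<xi>" using thr by simp
      qed measurable
      then have "u / 2 \<le> prob {\<xi>\<in>space N. wsum ?l {0} \<xi> \<ge> real n powr \<beta> * y} / 2" by simp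
      also have "\<dots> \<le> prob {\<xi>\<in>space N. wsum ?l (insert 0 ?F) \<xi> \<ge> real n powr \<beta> * y}"
        by (intro prob_wsum_superset) auto
      finally show "u / 2 \<le> prob {\<xi>\<in>space N. (\<Sum>k=0..n. \<eta> (S k \<omega>) \<xi>) \<ge> real n powr \<beta> * y}"
        by (subst path_sum_eq_wsum[where F="insert 0 ?F"]) auto
    qed
    finally show ?thesis unfolding z_def .
  qed
  then show ?thesis using c unfolding \<gamma>_def by blast
qed

section \<open>Region III: confinement with a favourable scenery\<close>

lemma finite_int_box: "finite {x :: int ^ 'd::finite. \<forall>i. \<bar>x $ i\<bar> \<le> int r}" (is "finite ?B")
  and card_int_box: "card {x :: int ^ 'd::finite. \<forall>i. \<bar>x $ i\<bar> \<le> int r} \<le> (2 * r + 1) ^ CARD('d)"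
proof -
  let ?P = "PiE (UNIV :: 'd set) (\<lambda>_. {- int r..int r})"
  have fin: "finite ?P" by (intro finite_PiE) auto
  have sub: "?B \<subseteq> vec_lambda ` ?P"
  proof
    fix x :: "int ^ 'd" assume x: "x \<in> ?B"
    have "- int r \<le> x $ i \<and> x $ i \<le> int r" for i using spec[of _ i, OF CollectD[OF x]] by linarith
    then have "vec_nth x \<in> ?P" by (simp add: PiE_def Pi_def)
    moreover have "x = vec_lambda (vec_nth x)" by simp
    ultimately show "x \<in> vec_lambda ` ?P" by blast
  qed
  show "finite ?B" by (rule finite_subset[OF sub]) (use fin in simp)
  have "card ?B \<le> card (vec_lambda ` ?P)" using fin sub by (intro card_mono) auto
  also have "\<dots> \<le> card ?P" by (rule card_image_le[OF fin])
  also have "\<dots> = (2 * r + 1) ^ CARD('d)"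
  proof -
    have "card {- int r..int r} = 2 * r + 1" unfolding card_atLeastAtMost_int by linarith
    then show ?thesis by (simp only: card_PiE finite_code prod_constant)
  qed
  finally show "card ?B \<le> (2 * r + 1) ^ CARD('d)" .
qed

text \<open>With u = a^2/2, the double-angle formula gives cos a \<ge> 1 - u, and 1 - u \<ge> exp(-2
  u) for u \<le> 1/2. This turns a power of the eigenvalue into an exponential.\<close>

lemma exp_minus_sq_le_cos:
  fixes a :: real
  assumes "\<bar>a\<bar> \<le> 1"
  shows "exp (- a\<^sup>2) \<le> cos a"
proof -
  have "\<bar>sin (a / 2)\<bar> \<le> \<bar>a / 2\<bar>" by (rule abs_sin_x_le_abs_x)
  then have "(sin (a / 2))\<^sup>2 \<le> (a / 2)\<^sup>2" by (rule abs_le_square_iff[THEN iffD1])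
  then have c: "1 - a\<^sup>2 / 2 \<le> cos a" using cos_double_sin[of "a / 2"] by (simp add: power_divide)
  define u where "u = a\<^sup>2 / 2"
  have "a\<^sup>2 \<le> 1" using assms by (simp add: abs_square_le_1)
  then have u: "0 \<le> u" "u \<le> 1 / 2" by (auto simp: u_def)
  have "u * u \<le> 1 / 2 * u" using u by (intro mult_right_mono) auto
  then have "- 2 * u \<le> ln (1 - u)"
    using ln_one_minus_pos_lower_bound[of u] u by (simp add: power2_eq_square)
  then have "exp (- 2 * u) \<le> 1 - u" using u by (simp add: ln_ge_iff)
  then show ?thesis using c by (simp add: u_def)
qed

lemma rwrs_lower_bound_region3:
  fixes S :: "nat \<Rightarrow> 'a \<Rightarrow> int ^ 'd::finite"
  assumes walk: "simple_random_walk M S" and scenery: "symmetric_iid N \<eta>"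
    and q: "measure N {\<xi>\<in>space N. \<eta> 0 \<xi> \<ge> y} > 0"
    and \<beta>: "0 \<le> \<beta>" "\<beta> \<le> 1" and y: "y > 0"
  shows "\<exists>c>0. \<forall>n\<ge>1. exp (- c * real n powr (\<beta> * real CARD('d) / (real CARD('d) + 2)))
     \<le> measure (M \<Otimes>\<^sub>M N) {\<omega>\<in>space (M \<Otimes>\<^sub>M N). rwrs S \<eta> n \<omega> \<ge> real n powr \<beta> * y}"
proof -
  interpret symmetric_iid N \<eta> by fact
  define d where "d = real CARD('d)"
  have d: "d > 0" by (simp add: d_def)
  define q where "q = prob {\<xi>\<in>space N. \<eta> 0 \<xi> \<ge> y}"
  have q01: "0 < q" "q \<le> 1" using assms(3) by (auto simp: q_def)
  \<comment> \<open>A side of the box has 2 r + 1 \<le> 2 \<rho> + 3 \<le> 5 \<rho> points because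
    \<rho> \<ge> 1, so the box has at most a z points.\<close>
  define a :: real where "a = 5 ^ CARD('d)"
  \<comment> \<open>The 4 is the confinement cost: T \<phi>^2 \<le> z \<rho>^2 (2/\<rho>)^2 = 4
    z.\<close>
  define c where "c = ln 2 - a * ln q + 4"
  have "a * ln q \<le> 0" using q01 by (intro mult_nonneg_nonpos) (auto simp: a_def)
  moreover have "ln (2 :: real) > 0" by simp
  ultimately have c: "c > 0" unfolding c_def by linarith
  have "exp (- c * real n powr (\<beta> * d / (d + 2)))
     \<le> measure (M \<Otimes>\<^sub>M N) {\<omega>\<in>space (M \<Otimes>\<^sub>M N). rwrs S \<eta> n \<omega> \<ge> real n powr \<beta> * y}" if n: "n \<ge> 1" for n
  proof -
    define z where "z = real n powr (\<beta> * d / (d + 2))"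
    \<comment> \<open>This scale equates the volume cost \<rho>^d and the confinement cost n^\<beta>
      / \<rho>^2; both are z.\<close>
    define \<rho> where "\<rho> = real n powr (\<beta> / (d + 2))"
    define r where "r = nat \<lceil>\<rho>\<rceil>"
    define T where "T = nat \<lfloor>real n powr \<beta>\<rfloor>"
    have z: "1 \<le> z" unfolding z_def using n \<beta> d by (intro ge_one_powr_ge_zero) auto
    have \<rho>: "1 \<le> \<rho>" unfolding \<rho>_def using n \<beta> d by (intro ge_one_powr_ge_zero) auto
    have r: "\<rho> \<le> real r" "real r \<le> \<rho> + 1" using \<rho> unfolding r_def by linarith+
    have nb: "1 \<le> real n powr \<beta>" "real n powr \<beta> \<le> real n"
      using n \<beta> powr_mono[of \<beta> 1 "real n"] by (auto simp: ge_one_powr_ge_zero)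
    have T: "real T \<le> real n powr \<beta>" "real n powr \<beta> \<le> real T + 1" using nb unfolding T_def by linarith+
    have Tn: "T \<le> n" using T nb by linarith
    have \<rho>d: "\<rho> ^ CARD('d) = z"
      using n by (simp add: \<rho>_def z_def d_def powr_power mult.commute)
    have \<rho>2: "real n powr \<beta> = z * \<rho>\<^sup>2"
    proof -
      have "\<beta> * d / (d + 2) + \<beta> / (d + 2) * 2 = \<beta> * (d + 2) / (d + 2)"
        unfolding times_divide_eq_left add_divide_distrib[symmetric] by (simp add: distrib_left)
      then have "\<beta> * d / (d + 2) + \<beta> / (d + 2) * 2 = \<beta>" using d by simp
      then show ?thesis using n by (simp add: \<rho>_def z_def powr_power powr_add[symmetric] mult.commute)
    qed
    define B where "B = {x :: int ^ 'd. \<forall>i. \<bar>x $ i\<bar> \<le> int r}"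
    have B: "finite B" unfolding B_def by (rule finite_int_box)
    have "real (card B) \<le> real ((2 * r + 1) ^ CARD('d))"
      unfolding B_def using card_int_box by (rule of_nat_mono)
    also have "\<dots> = (2 * real r + 1) ^ CARD('d)"
      by (simp only: of_nat_power of_nat_add of_nat_mult of_nat_numeral of_nat_1)
    also have "\<dots> \<le> (5 * \<rho>) ^ CARD('d)" using r \<rho> by (intro power_mono) auto
    finally have cB: "real (card B) \<le> a * z" by (simp add: a_def power_mult_distrib \<rho>d)
    define A where "A = {\<omega>\<in>space M. \<forall>k\<le>T. \<forall>i. \<bar>S k \<omega> $ i\<bar> \<le> int r}"
    define \<phi> where "\<phi> = pi / (2 * (real r + 1))"
    have "\<phi> = pi / 2 / (real r + 1)" by (simp add: \<phi>_def)
    also have "\<dots> \<le> 2 / (real r + 1)" using pi_less_4 by (intro divide_right_mono) auto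
    finally have \<phi>: "0 \<le> \<phi>" "\<phi> \<le> 2 / (real r + 1)" by (simp_all add: \<phi>_def)
    have "2 / (real r + 1) \<le> 1" by (subst divide_le_eq_1_pos) (use r \<rho> in linarith)+
    with \<phi> have "\<bar>\<phi>\<bar> \<le> 1" by linarith
    have "2 / (real r + 1) \<le> 2 / \<rho>"
      by (intro divide_left_mono mult_pos_pos) (use r \<rho> in linarith)+
    then have "\<phi>\<^sup>2 \<le> (2 / \<rho>)\<^sup>2" by (intro power_mono) (use \<phi> in linarith)+
    then have "real T * \<phi>\<^sup>2 \<le> (z * \<rho>\<^sup>2) * (2 / \<rho>)\<^sup>2"
      using T z by (intro mult_mono) (auto simp flip: \<rho>2)
    also have "\<dots> = 4 * z" using \<rho> by (simp add: power_divide)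
    finally have "exp (- 4 * z) \<le> exp (- \<phi>\<^sup>2) ^ T" by (simp add: exp_of_nat_mult[symmetric])
    also have "\<dots> \<le> cos \<phi> ^ T" using \<open>\<bar>\<phi>\<bar> \<le> 1\<close> by (intro power_mono exp_minus_sq_le_cos) auto
    also have "\<dots> \<le> measure M A" unfolding A_def \<phi>_def by (rule prob_walk_confined[OF walk])
    finally have u: "exp (- 4 * z) \<le> measure M A" .
    have "exp (- c * z) \<le> q ^ card B * (measure M A / 2)"
      unfolding c_def using q01 cB z u by (intro exp_le_power_mult) auto
    also have "\<dots> = measure M A * (q ^ card B / 2)" by simp
    also have "\<dots> \<le> measure (M \<Otimes>\<^sub>M N) {\<omega>\<in>space (M \<Otimes>\<^sub>M N). rwrs S \<eta> n \<omega> \<ge> real n powr \<beta> * y}"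
    proof (rule prob_rwrs_ge_by_conditioning[OF walk prob_space_axioms random_variable_scenery])
      show "A \<in> sets M"
        unfolding A_def by (rule sets_walk_constraint[OF walk])
      show "0 \<le> q ^ card B / 2" using q01 by simp
      fix \<omega> assume w: "\<omega> \<in> A"
      let ?s = "\<lambda>k. S k \<omega>"
      let ?l = "local_time ?s n" and ?F = "?s ` {0..n} \<union> B"
      \<comment> \<open>All times from 0 to T are spent in B, so T + 1 \<ge> n^\<beta> despite the
        rounding down. After T the path is free: further visits to B only help, and other sites are
        discarded by symmetry.\<close>
      have "real T + 1 = sum (local_time ?s T) B"
        using w B by (intro sum_local_time[symmetric]) (auto simp: A_def B_def)
      also have "\<dots> \<le> sum ?l B" by (intro sum_mono local_time_mono Tn)
      finally have "real n powr \<beta> * y \<le> y * sum ?l B" using T y by (simp add: mult.commute)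
      then have "prob {\<xi>\<in>space N. wsum ?l B \<xi> \<ge> y * sum ?l B} \<le> prob {\<xi>\<in>space N. wsum ?l B \<xi> \<ge> real n powr \<beta> * y}"
        by (intro finite_measure_mono) auto
      moreover have "q ^ card B \<le> prob {\<xi>\<in>space N. wsum ?l B \<xi> \<ge> y * sum ?l B}"
        unfolding q_def by (intro prob_wsum_ge_const B) simp
      moreover have "prob {\<xi>\<in>space N. wsum ?l B \<xi> \<ge> real n powr \<beta> * y} / 2
          \<le> prob {\<xi>\<in>space N. wsum ?l ?F \<xi> \<ge> real n powr \<beta> * y}"
        using B by (intro prob_wsum_superset) auto
      ultimately have "q ^ card B / 2 \<le> prob {\<xi>\<in>space N. wsum ?l ?F \<xi> \<ge> real n powr \<beta> * y}" by linarith
      then show "q ^ card B / 2 \<le> prob {\<xi>\<in>space N. (\<Sum>k=0..n. \<eta> (S k \<omega>) \<xi>) \<ge> real n powr \<beta> * y}"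
        using B by (subst path_sum_eq_wsum[where F="?F"]) auto
    qed
    finally show ?thesis unfolding z_def .
  qed
  then show ?thesis using c unfolding d_def by blast
qed

section \<open>Region I for the walk, and the final statement\<close>

text \<open>The scenery bound holds along every path, so the conditioning event is the whole space.
  The tail supplies the finite fourth moment and the positive variance behind the Paley-Zygmund
  constants.\<close>

lemma rwrs_lower_bound_region1:
  fixes S :: "nat \<Rightarrow> 'a \<Rightarrow> int ^ 'd::finite"
  assumes walk: "simple_random_walk M S" and scenery: "symmetric_iid N \<eta>"
    and tail: "has_tail_exponent N (\<eta> 0) \<alpha>" and \<alpha>: "\<alpha> > 1"
    and \<beta>: "1 / 2 < \<beta>" "\<beta> \<le> 1" and y: "y > 0"
  shows "\<exists>c>0. \<forall>n\<ge>1. exp (- c * real n powr (2 * \<beta> - 1))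
     \<le> measure (M \<Otimes>\<^sub>M N) {\<omega>\<in>space (M \<Otimes>\<^sub>M N). rwrs S \<eta> n \<omega> \<ge> real n powr \<beta> * y}"
proof -
  interpret M: prob_space M using walk by (simp add: simple_random_walk_def)
  interpret symmetric_iid N \<eta> by fact
  obtain c t0 where ct: "c > 0" "t0 \<ge> 1"
    and lb: "\<And>t. t \<ge> t0 \<Longrightarrow> exp (- 2 * c * t powr \<alpha>) \<le> prob {\<omega>\<in>space N. \<eta> 0 \<omega> > t}"
    and ub: "\<And>t. t \<ge> t0 \<Longrightarrow> prob {\<omega>\<in>space N. \<eta> 0 \<omega> > t} \<le> exp (- (c / 2) * t)"
    by (rule has_tail_exponent_bounds[OF tail less_imp_le[OF \<alpha>]]) (rule that)
  have int: "integrable N (\<lambda>\<omega>. \<eta> 0 \<omega> ^ 4)"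
    using integrable_power4_if_exp_tail[of "c / 2" t0 0] ct ub by simp
  have "prob {\<omega>\<in>space N. \<eta> 0 \<omega> > t0} > 0" using lb[of t0] by (intro less_le_trans[OF exp_gt_zero]) auto
  then have "expectation (\<lambda>\<omega>. \<eta> 0 \<omega> ^ 2) > 0"
    using ct by (intro variance_pos_if_unbounded[OF int, of t0]) auto
  then obtain \<theta> p where pz: "\<theta> > 0" "p > 0"
    "\<And>A w. finite A \<Longrightarrow> prob {\<omega>\<in>space N. wsum w A \<omega> \<ge> \<theta> * sqrt (\<Sum>x\<in>A. (w x)\<^sup>2)} \<ge> p"
    by (rule paley_zygmund_wsum[OF int]) (rule that)
  have "prob {\<omega>\<in>space N. \<eta> 0 \<omega> \<ge> y} > 0"
    using prob_ge_pos_if_tail_exponent[OF tail _ prob_space_axioms random_variable_scenery] \<alpha> y by simp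
  then have "\<exists>c>0. \<forall>n\<ge>1. \<forall>s. exp (- c * real n powr (2 * \<beta> - 1))
      \<le> prob {\<xi>\<in>space N. (\<Sum>k=0..n. \<eta> (s k) \<xi>) \<ge> real n powr \<beta> * y}"
    using \<beta> y by (intro prob_path_sum_region1[OF pz(1,2)] pz(3))
  then obtain b where b: "b > 0"
    and path: "\<And>n s. n \<ge> 1 \<Longrightarrow> exp (- b * real n powr (2 * \<beta> - 1))
      \<le> prob {\<xi>\<in>space N. (\<Sum>k=0..n. \<eta> (s k) \<xi>) \<ge> real n powr \<beta> * y}"
    by blast
  have "measure M (space M) * exp (- b * real n powr (2 * \<beta> - 1))
     \<le> measure (M \<Otimes>\<^sub>M N) {\<omega>\<in>space (M \<Otimes>\<^sub>M N). rwrs S \<eta> n \<omega> \<ge> real n powr \<beta> * y}" if "n \<ge> 1" for n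
    by (rule prob_rwrs_ge_by_conditioning[OF walk prob_space_axioms random_variable_scenery]) (use path[OF that] in auto)
  then show ?thesis using b by (auto simp: M.prob_space)
qed

theorem proposition1p3:
  fixes M :: "'a measure" and S :: "nat \<Rightarrow> 'a \<Rightarrow> int ^ 'd::finite"
    and N :: "'b measure" and \<eta> :: "int ^ 'd \<Rightarrow> 'b \<Rightarrow> real"
    and \<alpha> \<beta> :: real
  assumes dim: "CARD('d) \<ge> 3"
    and alpha: "\<alpha> > 1"
    and beta: "\<beta> > 1/2"
    and walk: "simple_random_walk M S"
    and scenery: "iid_centered_scenery N \<eta>"
    and tail: "has_tail_exponent N (\<eta> 0) \<alpha>"
    and bell: "bell_shaped N (\<eta> 0)"
  defines "P \<equiv> M \<Otimes>\<^sub>M N"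
  shows "(\<beta> \<le> 1 \<longrightarrow>
           (\<forall>y>0. \<exists>c\<^sub>1>0. \<forall>n\<ge>1.
              measure P {\<omega> \<in> space P. rwrs S \<eta> n \<omega> \<ge> real n powr \<beta> * y}
                \<ge> exp (- c\<^sub>1 * real n powr (2 * \<beta> - 1)))) \<and>
         (\<beta> \<le> 1 + 1 / \<alpha> \<longrightarrow>
           (\<forall>y>0. \<exists>c\<^sub>2>0. \<forall>n\<ge>1.
              measure P {\<omega> \<in> space P. rwrs S \<eta> n \<omega> \<ge> real n powr \<beta> * y}
                \<ge> exp (- c\<^sub>2 * real n powr (\<beta> * \<alpha> / (\<alpha> + 1))))) \<and>
         (\<beta> \<le> 1 \<longrightarrow>
           (\<forall>y>0. \<exists>c\<^sub>3>0. \<forall>n\<ge>1.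
              measure P {\<omega> \<in> space P. rwrs S \<eta> n \<omega> \<ge> real n powr \<beta> * y}
                \<ge> exp (- c\<^sub>3 * real n powr (\<beta> * real CARD('d) / (real CARD('d) + 2)))))"
proof -
  have sym: "symmetric_iid N \<eta>" by (rule symmetric_iid_scenery[OF scenery bell])
  have "prob_space N" and "\<eta> 0 \<in> borel_measurable N"
    using sym by (auto simp: symmetric_iid_def symmetric_iid.random_variable_scenery)
  then have pos: "measure N {\<xi>\<in>space N. \<eta> 0 \<xi> \<ge> y} > 0" if "y > 0" for y
    using prob_ge_pos_if_tail_exponent[OF tail] alpha that by simp
  show ?thesis
    unfolding P_def
  proof (intro conjI impI allI)
    fix y :: real assume "\<beta> \<le> 1" "y > 0"
    then show "\<exists>c>0. \<forall>n\<ge>1. exp (- c * real n powr (2 * \<beta> - 1))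
        \<le> measure (M \<Otimes>\<^sub>M N) {\<omega>\<in>space (M \<Otimes>\<^sub>M N). rwrs S \<eta> n \<omega> \<ge> real n powr \<beta> * y}"
      using beta by (intro rwrs_lower_bound_region1[OF walk sym tail alpha])
  next
    fix y :: real assume "\<beta> \<le> 1 + 1 / \<alpha>" "y > 0"
    then show "\<exists>c>0. \<forall>n\<ge>1. exp (- c * real n powr (\<beta> * \<alpha> / (\<alpha> + 1)))
        \<le> measure (M \<Otimes>\<^sub>M N) {\<omega>\<in>space (M \<Otimes>\<^sub>M N). rwrs S \<eta> n \<omega> \<ge> real n powr \<beta> * y}"
      using beta by (intro rwrs_lower_bound_region2[OF walk sym tail alpha]) auto
  next
    fix y :: real assume "\<beta> \<le> 1" "y > 0"
    then show "\<exists>c>0. \<forall>n\<ge>1. exp (- c * real n powr (\<beta> * real CARD('d) / (real CARD('d) + 2)))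
        \<le> measure (M \<Otimes>\<^sub>M N) {\<omega>\<in>space (M \<Otimes>\<^sub>M N). rwrs S \<eta> n \<omega> \<ge> real n powr \<beta> * y}"
      using beta by (intro rwrs_lower_bound_region3[OF walk sym pos]) auto
  qed
qed

end
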